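(* Let $f$ be a probability density on $\mathbb{R}$ such that $\int_{\mathbb{R}}x^2f(x)\,dx=1$ and $H(f\mid\gamma)<\infty$. Then $(\hat f^N)_N$ is entropically chaotic to $f$.
   Context: $\gamma(x)=\frac1{\sqrt{2\pi}}e^{-x^2/2}$ is the standard Gaussian density. The relative entropy of probability measures is $H(\mu\mid\nu)=\int h\log h\,d\nu$ with $h=d\mu/d\nu$, and $+\infty$ if $\mu\not\ll\nu$. Kac's sphere is $S^{N-1}=\{x\in\mathbb{R}^N:\sum_i x_i^2=N\}$, and $\sigma^N$ is the uniform probability measure on it. For $x\in\mathbb{R}^N\setminus\{0\}$ put $\hat x=\frac{\sqrt N}{|x|}x\in S^{N-1}$. $\hat f^N$ is the push-forward of $f^{\otimes N}$ under $x\mapsto\hat x$ (a probability measure on $S^{N-1}$). Kac chaos: a sequence $(F^N)_N$ of permutation-invariant probability measures on $\mathbb{R}^N$ is Kac chaotic to $f$ if for every $k\in\mathbb{N}$ the marginal of $F^N$ on its first $k$ coordinates converges weakly to $f^{\otimes k}$ as $N\to\infty$. Entropic chaos: a sequence $(F^N)_N$ of permutation-invariant probability measures on $S^{N-1}$ is entropically chaotic to $f$ (with $H(f\mid\gamma)<\infty$) if it is Kac chaotic to $f$ and $\lim_{N\to\infty}\frac1NH(F^N\mid\sigma^N)=H(f\mid\gamma)$. *)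

theory Defs
  imports "HOL-Probability.Probability"
begin

text \<open>
  Points of $\mathbb{R}^N$ are the functions \<^typ>\<open>nat \<Rightarrow> real\<close> that are \<^const>\<open>undefined\<close> outside
  \<open>{..<N}\<close>, so that the dimension can vary along a sequence.
\<close>

abbreviation borel_Rn :: "nat \<Rightarrow> (nat \<Rightarrow> real) measure" where
  "borel_Rn N \<equiv> PiM {..<N} (\<lambda>_. borel)"

abbreviation lborel_Rn :: "nat \<Rightarrow> (nat \<Rightarrow> real) measure" where
  "lborel_Rn N \<equiv> PiM {..<N} (\<lambda>_. lborel)"

abbreviation top_Rn :: "nat \<Rightarrow> (nat \<Rightarrow> real) topology" where
  "top_Rn N \<equiv> product_topology (\<lambda>_. euclideanreal) {..<N}"

abbreviation tensor_power :: "real measure \<Rightarrow> nat \<Rightarrow> (nat \<Rightarrow> real) measure" where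
  "tensor_power \<mu> N \<equiv> PiM {..<N} (\<lambda>_. \<mu>)"

text \<open>
  Unlike \<^const>\<open>KL_divergence\<close>, which is real-valued and hence $0$ when the integral diverges, the
  relative entropy takes the value $+\infty$. The integral of \<open>h log h\<close> is written as positive part
  minus negative part; the latter is finite when \<open>\<nu>\<close> is a probability measure. Note that
  \<open>absolutely_continuous \<nu> \<mu>\<close> means $\mu\ll\nu$, and that \<open>0 * ln 0 = 0\<close>.
\<close>

definition rel_entropy :: "'a measure \<Rightarrow> 'a measure \<Rightarrow> ereal" where
  "rel_entropy \<mu> \<nu> =
    (if absolutely_continuous \<nu> \<mu>
     then let h = (\<lambda>x. enn2real (RN_deriv \<nu> \<mu> x)) in
       enn2ereal (\<integral>\<^sup>+ x. ennreal (h x * ln (h x)) \<partial>\<nu>)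
       - enn2ereal (\<integral>\<^sup>+ x. ennreal (- (h x * ln (h x))) \<partial>\<nu>)
     else \<infinity>)"

definition kac_sphere :: "nat \<Rightarrow> (nat \<Rightarrow> real) set" where
  "kac_sphere N = {x \<in> space (borel_Rn N). (\<Sum>i<N. (x i)\<^sup>2) = real N}"

text \<open>
  The map $x\mapsto\hat x$. At the origin, where $\hat x$ is not defined, the value is the origin; for
  \<open>N \<ge> 1\<close> this is a null event for every measure to which the map is applied below.
\<close>

definition kac_proj :: "nat \<Rightarrow> (nat \<Rightarrow> real) \<Rightarrow> (nat \<Rightarrow> real)" where
  "kac_proj N x = (\<lambda>i\<in>{..<N}. sqrt (real N) / L2_set x {..<N} * x i)"

text \<open>
  Normalised surface measure: the mass of a Borel set \<open>A\<close> of the sphere is the proportion of the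
  volume of the unit ball occupied by the cone over \<open>A\<close>.
\<close>

definition unif_sphere :: "nat \<Rightarrow> (nat \<Rightarrow> real) measure" where
  "unif_sphere N =
    distr (uniform_measure (lborel_Rn N) {x \<in> space (lborel_Rn N). L2_set x {..<N} \<le> 1})
      (borel_Rn N) (kac_proj N)"

definition kac_pushforward :: "real measure \<Rightarrow> nat \<Rightarrow> (nat \<Rightarrow> real) measure" where
  "kac_pushforward \<mu> N = distr (tensor_power \<mu> N) (borel_Rn N) (kac_proj N)"

definition sym_prob :: "nat \<Rightarrow> (nat \<Rightarrow> real) measure \<Rightarrow> bool" where
  "sym_prob N P \<longleftrightarrow> prob_space P \<and> sets P = sets (borel_Rn N) \<and>
    (\<forall>p. p permutes {..<N} \<longrightarrow> distr P (borel_Rn N) (\<lambda>x. x \<circ> p) = P)"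

text \<open>
  \<^const>\<open>weak_conv_m\<close> only covers measures on the real line.
\<close>

definition weak_conv_top :: "'a topology \<Rightarrow> (nat \<Rightarrow> 'a measure) \<Rightarrow> 'a measure \<Rightarrow> bool" where
  "weak_conv_top X P Q \<longleftrightarrow>
    (\<forall>\<phi> :: 'a \<Rightarrow> real. continuous_map X euclideanreal \<phi> \<longrightarrow> bounded (\<phi> ` topspace X) \<longrightarrow>
      (\<lambda>n. \<integral>x. \<phi> x \<partial>P n) \<longlonglongrightarrow> (\<integral>x. \<phi> x \<partial>Q))"

definition marginal :: "nat \<Rightarrow> (nat \<Rightarrow> real) measure \<Rightarrow> (nat \<Rightarrow> real) measure" where
  "marginal k P = distr P (borel_Rn k) (\<lambda>x. restrict x {..<k})"

text \<open>
  Sequences are indexed by \<open>N \<ge> 1\<close>. The marginal on the first \<open>k\<close> coordinates is meaningful for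
  \<open>N \<ge> k\<close>, which is all that matters in the limit.
\<close>

definition kac_chaotic :: "(nat \<Rightarrow> (nat \<Rightarrow> real) measure) \<Rightarrow> real measure \<Rightarrow> bool" where
  "kac_chaotic F \<mu> \<longleftrightarrow> (\<forall>N\<ge>1. sym_prob N (F N)) \<and>
    (\<forall>k. weak_conv_top (top_Rn k) (\<lambda>N. marginal k (F N)) (tensor_power \<mu> k))"

abbreviation std_gaussian :: "real measure" where
  "std_gaussian \<equiv> density lborel (\<lambda>x. ennreal (std_normal_density x))"

text \<open>
  A probability measure on the sphere is a probability measure on $\mathbb{R}^N$ giving the sphere
  full mass.
\<close>

definition entropically_chaotic :: "(nat \<Rightarrow> (nat \<Rightarrow> real) measure) \<Rightarrow> real measure \<Rightarrow> bool" where
  "entropically_chaotic F \<mu> \<longleftrightarrow>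
    (\<forall>N\<ge>1. emeasure (F N) (kac_sphere N) = 1) \<and>
    kac_chaotic F \<mu> \<and>
    rel_entropy \<mu> std_gaussian < \<infinity> \<and>
    (\<lambda>N. ereal (1 / real N) * rel_entropy (F N) (unif_sphere N))
      \<longlonglongrightarrow> rel_entropy \<mu> std_gaussian"

end

theory Submission
  imports Defs
begin

text \<open>
  Both bounds on the entropy rest on the Donsker-Varadhan formula
  $H(\mu\mid\nu)=\sup_\Phi\,(\int\Phi\,d\mu-\ln\int e^\Phi\,d\nu)$, the supremum being over bounded
  measurable $\Phi$. The uniform measure on the sphere is the image of $\gamma^{\otimes N}$ under
  $x\mapsto\hat x$, so data processing gives
  $H(\hat f^N\mid\sigma^N)\le H(f^{\otimes N}\mid\gamma^{\otimes N})=N\,H(f\mid\gamma)$. For the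
  lower bound, test with $\Phi(x)=\sum_i\varphi(x_i)$, where $\varphi$ is bounded and uniformly
  continuous and nearly optimal for $H(f\mid\gamma)$. Chaos gives the limit of
  $\frac1N\int\Phi\,d\hat f^N$. Since $\hat x$ and $|x|$ are independent under $\gamma^{\otimes N}$,
  $\int e^\Phi\,d\sigma^N$ is an integral over $|x|^2\approx N$, where $\hat x$ is close to $x$,
  hence at most $e^{o(N)}(\int e^\varphi\,d\gamma)^N$. Chaos itself is the law of large numbers
  $|x|^2/N\to1$.
\<close>

section \<open>Relative entropy\<close>

text \<open>The density of \<open>kac_pushforward \<mu> N\<close> with respect to
  \<open>unif_sphere N\<close> is a radial integral without a convenient closed form, and no moment
  of \<open>f\<close> beyond the second is assumed that would control the law of |x|^2 more finely.
  The variational formula avoids both difficulties: of the projected measure only absolute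
  continuity is used, and the density of \<mu> with respect to the Gaussian enters before
  projection, where it is a product.

  The lower bound is shaped by the fact that the projection moves every point. A point and its
  projection are close only on average over the coordinates, so a merely measurable test function
  would not survive the comparison; uniform continuity turns averaged closeness into an error of N
  times a small constant. Such test functions come arbitrarily close to the supremum because \<mu>
  and the Gaussian both have Lebesgue densities. The event of the comparison only needs probability
  bounded below: a constant factor adds a bounded term to the logarithm, which division by N
  removes. Hence an L1 law of large numbers for the squares is the only limit theorem
  involved.\<close>

text \<open>Multiply ln (1/x) \<le> 1/x - 1 by x. Against a probability measure this bounds the
  integral of the negative part of h ln h by 1, so the difference in \<open>rel_entropy\<close> is
  never of the form \<infinity> - \<infinity>.\<close>

lemma neg_mult_ln_le_1: "- (x * ln x) \<le> 1" if "0 \<le> x" for x :: real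
proof (cases "x = 0")
  case False
  with that have "0 < x" by simp
  then have "ln (inverse x) \<le> inverse x - 1"
    by (intro ln_le_minus_one) simp
  with \<open>0 < x\<close> have "x * - ln x \<le> x * (inverse x - 1)"
    by (intro mult_left_mono) (auto simp: ln_inverse)
  also have "\<dots> = 1 - x"
    using \<open>0 < x\<close> by (simp add: algebra_simps)
  finally show ?thesis using \<open>0 < x\<close> by simp
qed simp

text \<open>Strict positivity matters because the logarithm of this integral occurs in every
  variational expression.\<close>

lemma (in prob_space) integral_exp_bounded:
  fixes X :: "'a \<Rightarrow> real"
  assumes [measurable]: "X \<in> borel_measurable M" and bd: "\<And>x. \<bar>X x\<bar> \<le> B"
  shows "integrable M (\<lambda>x. exp (X x))" and "0 < expectation (\<lambda>x. exp (X x))"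
proof -
  show int: "integrable M (\<lambda>x. exp (X x))"
    by (rule integrable_const_bound[where B="exp B"]) (use bd in \<open>auto simp: abs_le_iff\<close>)
  have "exp (- B) \<le> exp (X x)" for x using bd[of x] by (auto simp: abs_le_iff)
  then have "expectation (\<lambda>x. exp (- B)) \<le> expectation (\<lambda>x. exp (X x))"
    using int by (intro integral_mono) auto
  then have "exp (- B) \<le> expectation (\<lambda>x. exp (X x))" by (simp add: prob_space)
  then show "0 < expectation (\<lambda>x. exp (X x))" by (rule less_le_trans[OF exp_gt_zero])
qed

text \<open>Radon-Nikodym derivatives are unique almost everywhere, so the version picked by
  \<open>RN_deriv\<close> can be exchanged for any explicit density.\<close>

lemma rel_entropy_density:
  assumes Q: "prob_space Q"
    and [measurable]: "h \<in> borel_measurable Q" and h0: "\<And>x. 0 \<le> h x"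
    and P: "P = density Q (\<lambda>x. ennreal (h x))"
  shows "rel_entropy P Q = enn2ereal (\<integral>\<^sup>+ x. ennreal (h x * ln (h x)) \<partial>Q)
       - enn2ereal (\<integral>\<^sup>+ x. ennreal (- (h x * ln (h x))) \<partial>Q)"
proof -
  interpret Q: prob_space Q by fact
  have ac: "absolutely_continuous Q P"
    unfolding P by (rule absolutely_continuousI_density) measurable
  have "AE x in Q. ennreal (h x) = RN_deriv Q P x"
    using P by (intro Q.RN_deriv_unique) auto
  then have "AE x in Q. enn2real (RN_deriv Q P x) = h x"
    by eventually_elim (metis enn2real_ennreal h0)
  then have *: "(\<integral>\<^sup>+ x. g (enn2real (RN_deriv Q P x)) \<partial>Q) = (\<integral>\<^sup>+ x. g (h x) \<partial>Q)" for g
    by (intro nn_integral_cong_AE) auto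
  show ?thesis
    using ac *[of "\<lambda>x. ennreal (x * ln x)"] *[of "\<lambda>x. ennreal (- (x * ln x))"]
    by (simp add: rel_entropy_def Let_def)
qed

text \<open>The negative part has integral at most 1 by \<open>neg_mult_ln_le_1\<close>, so finite
  entropy forces a finite positive part. From here on entropy is an ordinary Bochner
  integral.\<close>

lemma rel_entropy_density_finite:
  assumes Q: "prob_space Q"
    and [measurable]: "h \<in> borel_measurable Q" and h0: "\<And>x. 0 \<le> h x"
    and P: "P = density Q (\<lambda>x. ennreal (h x))"
    and fin: "rel_entropy P Q < \<infinity>"
  shows "integrable Q (\<lambda>x. h x * ln (h x))"
    and "rel_entropy P Q = ereal (\<integral>x. h x * ln (h x) \<partial>Q)"
proof -
  interpret Q: prob_space Q by fact
  let ?p = "\<integral>\<^sup>+ x. ennreal (h x * ln (h x)) \<partial>Q" and ?n = "\<integral>\<^sup>+ x. ennreal (- (h x * ln (h x))) \<partial>Q"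
  have eq: "rel_entropy P Q = enn2ereal ?p - enn2ereal ?n"
    by (rule rel_entropy_density) fact+
  have "?n \<le> (\<integral>\<^sup>+ x. 1 \<partial>Q)"
    using neg_mult_ln_le_1[OF h0] by (intro nn_integral_mono) (simp add: ennreal_le_1)
  then have n: "?n < \<infinity>"
    by (simp add: Q.emeasure_space_1 ennreal_one_less_top order_le_less_trans)
  have p: "?p < \<infinity>"
    using fin n unfolding eq
    by (cases ?p; cases ?n) (auto simp: top_ereal_def infinity_ennreal_def)
  show int: "integrable Q (\<lambda>x. h x * ln (h x))"
    unfolding real_integrable_def using n p by auto
  show "rel_entropy P Q = ereal (\<integral>x. h x * ln (h x) \<partial>Q)"
    unfolding eq real_lebesgue_integral_def[OF int]
    using n p by (cases ?p; cases ?n) (auto simp: infinity_ennreal_def)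
qed

text \<open>Integrate \<open>1 + u \<le> exp u\<close> for \<open>u = \<Phi> - ln (\<integral>exp \<Phi> dQ) - ln (dP/dQ)\<close> against \<open>P\<close>.\<close>

lemma Gibbs_variational:
  fixes L \<Phi> :: "'a \<Rightarrow> real"
  assumes "prob_space Q" "prob_space P"
    and [measurable]: "h \<in> borel_measurable Q" and h0: "\<And>x. 0 \<le> h x"
    and P: "P = density Q (\<lambda>x. ennreal (h x))"
    and L: "integrable P L" and hL: "AE x in P. h x = exp (L x)"
    and [measurable]: "\<Phi> \<in> borel_measurable Q" and bd: "\<And>x. \<bar>\<Phi> x\<bar> \<le> B"
  shows "(\<integral>x. \<Phi> x \<partial>P) - ln (\<integral>x. exp (\<Phi> x) \<partial>Q) \<le> (\<integral>x. L x \<partial>P)"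
proof -
  interpret Q: prob_space Q by fact
  interpret P: prob_space P by fact
  have sets[measurable_cong]: "sets P = sets Q" by (simp add: P)
  have [measurable]: "L \<in> borel_measurable Q"
    using borel_measurable_integrable[OF L] by simp
  have intE: "integrable Q (\<lambda>x. exp (\<Phi> x))" and pos: "(\<integral>x. exp (\<Phi> x) \<partial>Q) > 0"
    using Q.integral_exp_bounded[OF _ bd] by auto
  have intP: "integrable P \<Phi>"
    by (rule P.integrable_const_bound[where B=B]) (use bd in auto)
  define c where "c = ln (\<integral>x. exp (\<Phi> x) \<partial>Q)"

  let ?g = "\<lambda>x. exp (\<Phi> x - c - L x)"
  \<comment> \<open>Where \<open>h x > 0\<close> the factor exp (- L x) cancels \<open>h x\<close>;
    where \<open>h x = 0\<close> the product vanishes whatever \<open>L x\<close> is. Discarding the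
    restriction to \<open>h x > 0\<close> afterwards is the second inequality of the proof.\<close>
  have AE: "AE x in Q. h x * ?g x = (if h x > 0 then exp (\<Phi> x - c) else 0)"
  proof -
    have "AE x in Q. 0 < ennreal (h x) \<longrightarrow> h x = exp (L x)"
      using hL unfolding P by (subst (asm) AE_density) auto
    then show ?thesis
    proof eventually_elim
      case (elim x)
      then show ?case
        using h0[of x] by (auto simp: exp_diff)
    qed
  qed
  have intif: "integrable Q (\<lambda>x. if h x > 0 then exp (\<Phi> x - c) else 0)"
    by (rule Q.integrable_const_bound[where B="exp (B - c)"]) (use bd in \<open>auto simp: abs_le_iff\<close>)
  have intg: "integrable P ?g"
  proof -
    have "integrable Q (\<lambda>x. h x * ?g x)"
      using AE by (intro integrable_cong_AE_imp[OF intif]) auto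
    then show ?thesis
      unfolding P by (subst integrable_density) (simp_all add: h0)
  qed
  have intEc: "integrable Q (\<lambda>x. exp (\<Phi> x - c))"
    using intE by (simp add: exp_diff)
  have "(\<integral>x. 1 + (\<Phi> x - c - L x) \<partial>P) \<le> (\<integral>x. ?g x \<partial>P)"
    using intP L intg by (intro integral_mono exp_ge_add_one_self) auto
  also have "\<dots> = (\<integral>x. h x * ?g x \<partial>Q)"
    unfolding P by (subst integral_density) (auto simp: h0)
  also have "\<dots> = (\<integral>x. (if h x > 0 then exp (\<Phi> x - c) else 0) \<partial>Q)"
    by (intro integral_cong_AE AE) auto
  also have "\<dots> \<le> (\<integral>x. exp (\<Phi> x - c) \<partial>Q)"
    by (intro integral_mono intif intEc) auto
  also have "\<dots> = 1"
    using pos by (simp add: exp_diff c_def)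
  finally show ?thesis
    using intP L by (simp add: P.prob_space c_def)
qed

text \<open>Infinite entropy leaves nothing to prove. Otherwise ln h is integrable under P, and
  \<open>Gibbs_variational\<close> applies with \<open>L\<close> = ln h.\<close>

lemma Donsker_Varadhan_le:
  fixes \<Phi> :: "'a \<Rightarrow> real"
  assumes "prob_space Q" "prob_space P"
    and ac: "absolutely_continuous Q P" and sets: "sets P = sets Q"
    and [measurable]: "\<Phi> \<in> borel_measurable Q" and bd: "\<And>x. \<bar>\<Phi> x\<bar> \<le> B"
  shows "ereal ((\<integral>x. \<Phi> x \<partial>P) - ln (\<integral>x. exp (\<Phi> x) \<partial>Q)) \<le> rel_entropy P Q"
proof (cases "rel_entropy P Q < \<infinity>")
  case True
  interpret Q: prob_space Q by fact
  interpret P: prob_space P by fact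
  define h where "h x = enn2real (RN_deriv Q P x)" for x
  have [measurable]: "h \<in> borel_measurable Q" unfolding h_def by measurable
  have h0: "0 \<le> h x" for x by (simp add: h_def)
  have "AE x in Q. RN_deriv Q P x \<noteq> \<infinity>"
    by (rule Q.RN_deriv_finite[OF _ ac sets]) (rule P.sigma_finite_measure)
  then have "density Q (RN_deriv Q P) = density Q (\<lambda>x. ennreal (h x))"
    by (intro density_cong) (auto simp: h_def less_top)
  with Q.density_RN_deriv[OF ac sets] have P: "P = density Q (\<lambda>x. ennreal (h x))" by simp
  note fin = rel_entropy_density_finite[OF assms(1) _ h0 P True]
  have int: "integrable P (\<lambda>x. ln (h x))"
    unfolding P using fin(1) by (subst integrable_density) (auto simp: h0)
  have eq: "(\<integral>x. ln (h x) \<partial>P) = (\<integral>x. h x * ln (h x) \<partial>Q)"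
    unfolding P by (subst integral_density) (auto simp: h0)
  \<comment> \<open>P gives no mass to the set where \<open>h x = 0\<close>, the only place where
    this identity fails.\<close>
  have "AE x in P. h x = exp (ln (h x))"
    unfolding P by (subst AE_density) auto
  from Gibbs_variational[OF assms(1,2) _ h0 P int this _ bd] show ?thesis
    by (simp add: fin(2) eq)
qed auto

text \<open>
  The supremum is approached along \<open>\<Phi> = ln h\<close> truncated to \<open>[- ln n, ln n]\<close>; Fatou's lemma applies
  because \<open>h * \<Phi> \<ge> -1\<close>.
\<close>

lemma rel_entropy_le_Donsker_Varadhan:
  assumes "prob_space Q" "prob_space P"
    and ac: "absolutely_continuous Q P" and sets: "sets P = sets Q"
    and C: "\<And>\<Phi> B. \<Phi> \<in> borel_measurable Q \<Longrightarrow> (\<And>x. \<bar>\<Phi> x :: real\<bar> \<le> B) \<Longrightarrow>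
      (\<integral>x. \<Phi> x \<partial>P) - ln (\<integral>x. exp (\<Phi> x) \<partial>Q) \<le> C"
  shows "rel_entropy P Q \<le> ereal C"
proof -
  interpret Q: prob_space Q by fact
  interpret P: prob_space P by fact
  define h where "h x = enn2real (RN_deriv Q P x)" for x
  have [measurable]: "h \<in> borel_measurable Q" unfolding h_def by measurable
  have h0: "0 \<le> h x" for x by (simp add: h_def)
  have "AE x in Q. RN_deriv Q P x \<noteq> \<infinity>"
    by (rule Q.RN_deriv_finite[OF _ ac sets]) (rule P.sigma_finite_measure)
  then have "density Q (RN_deriv Q P) = density Q (\<lambda>x. ennreal (h x))"
    by (intro density_cong) (auto simp: h_def less_top)
  with Q.density_RN_deriv[OF ac sets] have P: "P = density Q (\<lambda>x. ennreal (h x))" by simp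
  have "(\<integral>\<^sup>+x. ennreal (h x) \<partial>Q) = emeasure P (space P)"
    by (simp add: P emeasure_density cong: nn_integral_cong)
  then have nnh: "(\<integral>\<^sup>+x. ennreal (h x) \<partial>Q) = 1" by (simp add: P.emeasure_space_1)
  have inth: "integrable Q h" and hint: "(\<integral>x. h x \<partial>Q) = 1"
    using nnh h0 by (auto simp: integrable_iff_bounded integral_eq_nn_integral)
  \<comment> \<open>Truncating \<open>h\<close> instead of its logarithm makes exp (\<Phi> n x)
    equal to \<open>t n x\<close>, whose integral is easy to compare with that of \<open>h\<close>.
    With \<open>Suc n\<close> both bounds are meaningful already at n = 0, where they
    coincide.\<close>
  define t where "t n x = max (min (h x) (real (Suc n))) (1 / real (Suc n))" for n x
  define \<Phi> where "\<Phi> n x = ln (t n x)" for n x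
  have [measurable]: "t n \<in> borel_measurable Q" "\<Phi> n \<in> borel_measurable Q" for n
    unfolding t_def \<Phi>_def by measurable
  have t1: "1 / real (Suc n) \<le> t n x" for n x by (simp add: t_def)
  have t2: "t n x \<le> real (Suc n)" for n x
  proof -
    have "1 / real (Suc n) \<le> 1" "1 \<le> real (Suc n)" by simp_all
    then show ?thesis unfolding t_def by linarith
  qed
  have tpos: "0 < t n x" for n x
  proof -
    have "0 < 1 / real (Suc n)" by simp
    then show ?thesis using t1[of n x] by linarith
  qed
  have \<Phi>bd: "\<bar>\<Phi> n x\<bar> \<le> ln (real (Suc n))" for n x
  proof -
    have "ln (1 / real (Suc n)) \<le> \<Phi> n x" unfolding \<Phi>_def
      using t1 tpos by (subst ln_le_cancel_iff) auto
    moreover have "\<Phi> n x \<le> ln (real (Suc n))" unfolding \<Phi>_def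
      using t2 tpos by (subst ln_le_cancel_iff) auto
    ultimately show ?thesis by (auto simp: ln_div)
  qed
  have intP: "integrable P (\<Phi> n)" for n
    by (rule P.integrable_const_bound[where B="ln (real (Suc n))"])
      (use \<Phi>bd in \<open>auto simp: P\<close>)
  have inthP: "integrable Q (\<lambda>x. h x * \<Phi> n x)" for n
    using intP[of n] unfolding P by (subst (asm) integrable_density) (auto simp: h0)
  \<comment> \<open>Where h \<le> 1 the truncation can only increase h, so the value is at least h
    ln h; where h > 1 the truncated value is at least 1 and its logarithm is nonnegative.\<close>
  have lower: "- 1 \<le> h x * \<Phi> n x" for n x
  proof (cases "h x \<le> 1")
    case True
    show ?thesis
    proof (cases "h x = 0")
      case False
      with h0[of x] have "h x > 0" by simp
      have "h x \<le> t n x" using True by (auto simp: t_def)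
      then have "h x * ln (h x) \<le> h x * \<Phi> n x"
        unfolding \<Phi>_def using \<open>h x > 0\<close> by (intro mult_left_mono) auto
      then show ?thesis using neg_mult_ln_le_1[OF h0[of x]] by linarith
    qed auto
  next
    case False
    then have "1 \<le> t n x" by (auto simp: t_def)
    then have "0 \<le> \<Phi> n x" by (simp add: \<Phi>_def)
    then show ?thesis using h0[of x] by (smt (verit) mult_nonneg_nonneg)
  qed
  \<comment> \<open>The logarithmic term costs at most 1 / (n + 1): apply ln y \<le> y - 1 to the
    integral y of \<open>t n\<close>, which exceeds the integral 1 of \<open>h\<close> by no more
    than that.\<close>
  have upper: "(\<integral>x. h x * \<Phi> n x \<partial>Q) \<le> C + 1 / real (Suc n)" for n
  proof -
    have intt: "integrable Q (t n)"
      by (rule Q.integrable_const_bound[where B="real (Suc n)"])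
        (use t2 tpos in \<open>auto simp: abs_of_pos\<close>)
    have "(\<integral>x. h x * \<Phi> n x \<partial>Q) = (\<integral>x. \<Phi> n x \<partial>P)"
      unfolding P by (subst integral_density) (auto simp: h0)
    also have "\<dots> \<le> C + ln (\<integral>x. exp (\<Phi> n x) \<partial>Q)"
      using C[of "\<Phi> n" "ln (real (Suc n))"] \<Phi>bd by force
    also have "(\<integral>x. exp (\<Phi> n x) \<partial>Q) = (\<integral>x. t n x \<partial>Q)"
      using tpos by (simp add: \<Phi>_def)
    also have "ln \<dots> \<le> (\<integral>x. t n x \<partial>Q) - 1"
    proof (rule ln_le_minus_one)
      have "(\<integral>x. 1 / real (Suc n) \<partial>Q) \<le> (\<integral>x. t n x \<partial>Q)"
        using t1 intt by (intro integral_mono) auto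
      then show "0 < (\<integral>x. t n x \<partial>Q)"
        by (simp add: Q.prob_space) (smt (verit) divide_pos_pos of_nat_0_le_iff)
    qed
    also have "(\<integral>x. t n x \<partial>Q) \<le> (\<integral>x. h x + 1 / real (Suc n) \<partial>Q)"
    proof (intro integral_mono)
      show "t n x \<le> h x + 1 / real (Suc n)" for x
      proof -
        have "0 \<le> 1 / real (Suc n)" by simp
        then show ?thesis using h0[of x] unfolding t_def by linarith
      qed
    qed (use intt inth in auto)
    also have "\<dots> = 1 + 1 / real (Suc n)"
      using inth by (simp add: hint Q.prob_space)
    finally show ?thesis by simp
  qed
  \<comment> \<open>Where h > 0 the truncation is eventually inactive; where h = 0 the factor
    \<open>h x\<close> hides the divergence of \<Phi>.\<close>
  have lim: "(\<lambda>n. h x * \<Phi> n x) \<longlonglongrightarrow> h x * ln (h x)" for x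
  proof (cases "h x = 0")
    case False
    with h0[of x] have pos: "h x > 0" by simp
    have "(\<lambda>n. 1 / real (Suc n)) \<longlonglongrightarrow> 0" by (rule LIMSEQ_Suc[OF lim_1_over_n])
    from order_tendstoD(2)[OF this pos]
    have e1: "\<forall>\<^sub>F n in sequentially. 1 / real (Suc n) < h x" .
    have "filterlim (\<lambda>n. real (Suc n)) at_top sequentially"
      by (rule filterlim_compose[OF filterlim_real_sequentially filterlim_Suc])
    then have e2: "\<forall>\<^sub>F n in sequentially. h x \<le> real (Suc n)"
      by (auto simp: filterlim_at_top)
    have "\<forall>\<^sub>F n in sequentially. h x * \<Phi> n x = h x * ln (h x)"
      using e1 e2 by eventually_elim (auto simp: \<Phi>_def t_def)
    then show ?thesis by (rule tendsto_eventually)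
  qed auto
  \<comment> \<open>The test function 0 gives C \<ge> 0, so converting C + 1 to
    \<open>ennreal\<close> does not cut it off. The shift by 1 makes all integrands in the Fatou
    argument nonnegative.\<close>
  have C1: "0 \<le> C + 1"
    using C[of "\<lambda>_. 0" 0] by (simp add: Q.prob_space)
  have "(\<integral>\<^sup>+x. ennreal (h x * ln (h x) + 1) \<partial>Q) = (\<integral>\<^sup>+x. liminf (\<lambda>n. ennreal (h x * \<Phi> n x + 1)) \<partial>Q)"
    by (intro nn_integral_cong lim_imp_Liminf[symmetric] tendsto_intros lim) auto
  also have "\<dots> \<le> liminf (\<lambda>n. \<integral>\<^sup>+x. ennreal (h x * \<Phi> n x + 1) \<partial>Q)"
    by (intro nn_integral_liminf) auto
  also have "\<dots> \<le> liminf (\<lambda>n. ennreal (C + 1 / real (Suc n) + 1))"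
  proof (intro Liminf_mono always_eventually allI)
    fix n
    have "0 \<le> h x * \<Phi> n x + 1" for x using lower[of x n] by simp
    then have "(\<integral>\<^sup>+x. ennreal (h x * \<Phi> n x + 1) \<partial>Q) = ennreal (\<integral>x. h x * \<Phi> n x + 1 \<partial>Q)"
      using inthP[of n] by (intro nn_integral_eq_integral) auto
    also have "(\<integral>x. h x * \<Phi> n x + 1 \<partial>Q) \<le> C + 1 / real (Suc n) + 1"
      using upper[of n] inthP[of n] by (simp add: Q.prob_space)
    finally show "(\<integral>\<^sup>+x. ennreal (h x * \<Phi> n x + 1) \<partial>Q) \<le> ennreal (C + 1 / real (Suc n) + 1)"
      by (simp add: ennreal_leI)
  qed
  also have "\<dots> = ennreal (C + 0 + 1)"
    by (intro lim_imp_Liminf tendsto_intros LIMSEQ_Suc[OF lim_1_over_n]) auto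
  finally have le: "(\<integral>\<^sup>+x. ennreal (h x * ln (h x) + 1) \<partial>Q) \<le> ennreal (C + 1)" by simp
  have nn: "0 \<le> h x * ln (h x) + 1" for x
    using neg_mult_ln_le_1[OF h0[of x]] by simp
  have int: "integrable Q (\<lambda>x. h x * ln (h x) + 1)"
    using le nn by (intro integrableI_bounded) (auto simp: le_less_trans)
  have "(\<integral>x. h x * ln (h x) + 1 \<partial>Q) \<le> C + 1"
    using le C1 nn int by (subst (asm) nn_integral_eq_integral) auto
  moreover have int': "integrable Q (\<lambda>x. h x * ln (h x))"
    using Bochner_Integration.integrable_diff[OF int Q.integrable_const[of 1]] by simp
  ultimately have fin: "(\<integral>x. h x * ln (h x) \<partial>Q) \<le> C"
    by (simp add: Q.prob_space)
  have "rel_entropy P Q < \<infinity>"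
    unfolding rel_entropy_density[OF assms(1) _ h0 P, simplified]
    using int' unfolding real_integrable_def
    by (cases "\<integral>\<^sup>+ x. ennreal (h x * ln (h x)) \<partial>Q"; cases "\<integral>\<^sup>+ x. ennreal (- (h x * ln (h x))) \<partial>Q")
       (auto simp: infinity_ennreal_def)
  from rel_entropy_density_finite(2)[OF assms(1) _ h0 P this] fin show ?thesis by simp
qed

section \<open>Radial measures\<close>

text \<open>A product measure is determined by its values on boxes, and over a box the integral of
  the product density factors.\<close>

lemma PiM_density:
  fixes g :: "'i \<Rightarrow> 'a \<Rightarrow> ennreal"
  assumes I: "finite I" and "product_sigma_finite M" "product_sigma_finite (\<lambda>i. density (M i) (g i))"
    and [measurable]: "\<And>i. i \<in> I \<Longrightarrow> g i \<in> borel_measurable (M i)"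
  shows "PiM I (\<lambda>i. density (M i) (g i)) = density (PiM I M) (\<lambda>x. \<Prod>i\<in>I. g i (x i))"
proof -
  interpret M: product_sigma_finite M by fact
  interpret D: product_sigma_finite "\<lambda>i. density (M i) (g i)" by fact
  have meas[measurable]: "(\<lambda>x. \<Prod>i\<in>I. g i (x i)) \<in> borel_measurable (PiM I M)"
    by measurable
  show ?thesis
  proof (rule D.PiM_eqI[symmetric, OF I])
    show "sets (density (PiM I M) (\<lambda>x. \<Prod>i\<in>I. g i (x i))) = sets (PiM I (\<lambda>i. density (M i) (g i)))"
      by (auto intro!: sets_PiM_cong)
    fix A assume "\<And>i. i \<in> I \<Longrightarrow> A i \<in> sets (density (M i) (g i))"
    then have A[measurable]: "\<And>i. i \<in> I \<Longrightarrow> A i \<in> sets (M i)" by simp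
    then have PA: "Pi\<^sub>E I A \<in> sets (PiM I M)"
      using I by (intro sets_PiM_I_finite) auto
    have "emeasure (density (PiM I M) (\<lambda>x. \<Prod>i\<in>I. g i (x i))) (Pi\<^sub>E I A)
        = (\<integral>\<^sup>+x. (\<Prod>i\<in>I. g i (x i)) * indicator (Pi\<^sub>E I A) x \<partial>PiM I M)"
      by (rule emeasure_density[OF meas PA])
    also have "\<dots> = (\<integral>\<^sup>+x. (\<Prod>i\<in>I. g i (x i) * indicator (A i) (x i)) \<partial>PiM I M)"
    proof (intro nn_integral_cong)
      fix x assume x: "x \<in> space (PiM I M)"
      then have "indicator (Pi\<^sub>E I A) x = (\<Prod>i\<in>I. indicator (A i) (x i) :: ennreal)"
        using I by (auto simp: indicator_def space_PiM PiE_iff prod_zero_iff)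
      then show "(\<Prod>i\<in>I. g i (x i)) * indicator (Pi\<^sub>E I A) x = (\<Prod>i\<in>I. g i (x i) * indicator (A i) (x i))"
        by (simp add: prod.distrib)
    qed
    also have "\<dots> = (\<Prod>i\<in>I. \<integral>\<^sup>+x. g i x * indicator (A i) x \<partial>M i)"
      using I by (intro M.product_nn_integral_prod) auto
    also have "\<dots> = (\<Prod>i\<in>I. emeasure (density (M i) (g i)) (A i))"
      by (intro prod.cong refl) (simp add: emeasure_density)
    finally show "emeasure (density (PiM I M) (\<lambda>x. \<Prod>i\<in>I. g i (x i))) (Pi\<^sub>E I A)
        = (\<Prod>i\<in>I. emeasure (density (M i) (g i)) (A i))" .
  qed
qed

section \<open>Dilations and the volume of cones\<close>

text \<open>Each side of a box contributes one factor c by the one-dimensional scaling rule; N sides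
  give the Jacobian c^N.\<close>

lemma lborel_Rn_scale:
  assumes "0 < c"
  shows "lborel_Rn N = density (distr (lborel_Rn N) (lborel_Rn N) (\<lambda>x. \<lambda>i\<in>{..<N}. c * x i)) (\<lambda>_. ennreal (c ^ N))"
proof -
  interpret L: product_sigma_finite "\<lambda>_::nat. lborel :: real measure"
    by unfold_locales
  have T[measurable]: "(\<lambda>x. \<lambda>i\<in>{..<N}. c * x i) \<in> measurable (lborel_Rn N) (lborel_Rn N)"
    by measurable
  show ?thesis
  proof (rule L.PiM_eqI[symmetric])
    fix A :: "nat \<Rightarrow> real set" assume A: "\<And>i. i \<in> {..<N} \<Longrightarrow> A i \<in> sets lborel"
    have [measurable]: "Pi\<^sub>E {..<N} A \<in> sets (lborel_Rn N)"
      using A by (intro sets_PiM_I_finite) auto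
    have pre: "(\<lambda>x. \<lambda>i\<in>{..<N}. c * x i) -` Pi\<^sub>E {..<N} A \<inter> space (lborel_Rn N)
        = (\<Pi>\<^sub>E i\<in>{..<N}. (*) c -` A i)"
      by (auto simp: space_PiM PiE_iff)
    have 1: "emeasure lborel (A i) = ennreal c * emeasure lborel ((*) c -` A i)" if "i < N" for i
    proof -
      have [measurable]: "A i \<in> sets borel" using A that by simp
      have "emeasure lborel (A i) = emeasure (density (distr lborel borel ((*) c)) (\<lambda>_. \<bar>c\<bar>)) (A i)"
        using lborel_distr_mult'[of c] assms by simp
      also have "\<dots> = ennreal c * emeasure lborel ((*) c -` A i)"
        using assms by (simp add: emeasure_density nn_integral_cmult emeasure_distr)
      finally show ?thesis .
    qed
    have Ac: "(*) c -` A i \<in> sets lborel" if "i < N" for i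
    proof -
      have [measurable]: "A i \<in> sets borel" using A that by simp
      have "(*) c -` A i \<inter> space borel \<in> sets borel" by measurable
      then show ?thesis by simp
    qed
    have "emeasure (density (distr (lborel_Rn N) (lborel_Rn N) (\<lambda>x. \<lambda>i\<in>{..<N}. c * x i)) (\<lambda>_. ennreal (c ^ N))) (Pi\<^sub>E {..<N} A)
      = ennreal (c ^ N) * emeasure (lborel_Rn N) (\<Pi>\<^sub>E i\<in>{..<N}. (*) c -` A i)"
      by (simp add: emeasure_density nn_integral_cmult emeasure_distr pre)
    also have "\<dots> = ennreal (c ^ N) * (\<Prod>i<N. emeasure lborel ((*) c -` A i))"
      using Ac by (subst L.emeasure_PiM) auto
    also have "\<dots> = (\<Prod>i<N. emeasure lborel (A i))"
      using assms by (simp add: 1 prod.distrib ennreal_power)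
    finally show "emeasure (density (distr (lborel_Rn N) (lborel_Rn N) (\<lambda>x. \<lambda>i\<in>{..<N}. c * x i)) (\<lambda>_. ennreal (c ^ N))) (Pi\<^sub>E {..<N} A)
      = (\<Prod>i<N. emeasure lborel (A i))" .
  qed auto
qed

lemma L2_set_restrict_mult: "0 \<le> c \<Longrightarrow> L2_set (\<lambda>i\<in>{..<N}. c * x i) {..<N} = c * L2_set x {..<N}"
  by (subst L2_set_right_distrib) (auto intro!: L2_set_cong)

lemma kac_proj_scale:
  assumes "0 < c"
  shows "kac_proj N (\<lambda>i\<in>{..<N}. c * x i) = kac_proj N x"
  using assms by (simp add: kac_proj_def L2_set_restrict_mult fun_eq_iff cong: restrict_cong)

lemma measurable_L2_set [measurable]:
  "(\<lambda>x. L2_set x {..<N}) \<in> borel_measurable (borel_Rn N)"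
  unfolding L2_set_def by measurable

lemma measurable_kac_proj [measurable]: "kac_proj N \<in> measurable (borel_Rn N) (borel_Rn N)"
  unfolding kac_proj_def[abs_def] by measurable

lemma sets_lborel_Rn [measurable_cong]: "sets (lborel_Rn N) = sets (borel_Rn N)"
  by (intro sets_PiM_cong) auto

text \<open>\<open>kac_proj\<close> is homogeneous of degree 0, so a dilation maps the cone over B
  to itself and changes only the radius of the ball.\<close>

lemma emeasure_cone_ball_scale:
  assumes "0 < c" and [measurable]: "B \<in> sets (borel_Rn N)"
  shows "emeasure (lborel_Rn N) {x \<in> space (lborel_Rn N). kac_proj N x \<in> B \<and> L2_set x {..<N} \<le> c * r}
    = ennreal (c ^ N) * emeasure (lborel_Rn N) {x \<in> space (lborel_Rn N). kac_proj N x \<in> B \<and> L2_set x {..<N} \<le> r}"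
    (is "emeasure _ ?A = _ * emeasure _ ?A'")
proof -
  have T[measurable]: "(\<lambda>x. \<lambda>i\<in>{..<N}. c * x i) \<in> measurable (lborel_Rn N) (lborel_Rn N)"
    by measurable
  have [measurable]: "?A \<in> sets (lborel_Rn N)" by measurable
  have pre: "(\<lambda>x. \<lambda>i\<in>{..<N}. c * x i) -` ?A \<inter> space (lborel_Rn N) = ?A'"
    using assms(1) by (auto simp: kac_proj_scale L2_set_restrict_mult space_PiM)
  have "emeasure (lborel_Rn N) ?A = emeasure (density (distr (lborel_Rn N) (lborel_Rn N) (\<lambda>x. \<lambda>i\<in>{..<N}. c * x i)) (\<lambda>_. ennreal (c ^ N))) ?A"
    using lborel_Rn_scale[OF assms(1), of N] by simp
  also have "\<dots> = ennreal (c ^ N) * emeasure (distr (lborel_Rn N) (lborel_Rn N) (\<lambda>x. \<lambda>i\<in>{..<N}. c * x i)) ?A"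
    by (simp add: emeasure_density nn_integral_cmult)
  also have "\<dots> = ennreal (c ^ N) * emeasure (lborel_Rn N) ?A'"
    by (subst emeasure_distr[OF T]) (measurable, simp only: pre)
  finally show ?thesis .
qed

lemma emeasure_ball_Rn_finite:
  "emeasure (lborel_Rn N) {x \<in> space (lborel_Rn N). L2_set x {..<N} \<le> r} < \<infinity>"
proof -
  interpret L: product_sigma_finite "\<lambda>_::nat. lborel :: real measure"
    by unfold_locales
  have "emeasure (lborel_Rn N) {x \<in> space (lborel_Rn N). L2_set x {..<N} \<le> r}
      \<le> emeasure (lborel_Rn N) (\<Pi>\<^sub>E i\<in>{..<N}. {-\<bar>r\<bar>..\<bar>r\<bar>})"
  proof (rule emeasure_mono)
    show "{x \<in> space (lborel_Rn N). L2_set x {..<N} \<le> r} \<subseteq> (\<Pi>\<^sub>E i\<in>{..<N}. {-\<bar>r\<bar>..\<bar>r\<bar>})"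
    proof
      fix x assume x: "x \<in> {x \<in> space (lborel_Rn N). L2_set x {..<N} \<le> r}"
      have "\<bar>x i\<bar> \<le> \<bar>r\<bar>" if "i < N" for i
        using member_le_L2_set[of "{..<N}" i "\<lambda>i. \<bar>x i\<bar>"] that x
        by (auto simp: L2_set_def)
      with x show "x \<in> (\<Pi>\<^sub>E i\<in>{..<N}. {-\<bar>r\<bar>..\<bar>r\<bar>})"
        by (auto simp: space_PiM PiE_iff abs_le_iff) (smt (verit))
    qed
  qed (auto intro!: sets_PiM_I_finite)
  also have "\<dots> = (\<Prod>i<N. emeasure lborel {-\<bar>r\<bar>..\<bar>r\<bar>})"
    by (subst L.emeasure_PiM) auto
  also have "\<dots> < \<infinity>"
    by (simp add: power_less_top_ennreal)
  finally show ?thesis .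
qed

lemma emeasure_unit_ball_Rn_pos:
  "0 < emeasure (lborel_Rn N) {x \<in> space (lborel_Rn N). L2_set x {..<N} \<le> 1}"
proof -
  interpret L: product_sigma_finite "\<lambda>_::nat. lborel :: real measure"
    by unfold_locales
  \<comment> \<open>On the cube with this side the sum of the coordinates is at most N / (N + 1),
    hence so is the Euclidean norm; \<open>Suc N\<close> avoids division by 0 for N = 0.\<close>
  define a where "a = 1 / real (Suc N)"
  have a: "0 < a" by (simp add: a_def)
  have "0 < (\<Prod>i<N. emeasure lborel {0..a})"
    using a by (simp add: ennreal_power)
  also have "\<dots> = emeasure (lborel_Rn N) (\<Pi>\<^sub>E i\<in>{..<N}. {0..a})"
    by (subst L.emeasure_PiM) auto
  also have "\<dots> \<le> emeasure (lborel_Rn N) {x \<in> space (lborel_Rn N). L2_set x {..<N} \<le> 1}"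
  proof (rule emeasure_mono)
    show "(\<Pi>\<^sub>E i\<in>{..<N}. {0..a}) \<subseteq> {x \<in> space (lborel_Rn N). L2_set x {..<N} \<le> 1}"
    proof
      fix x assume x: "x \<in> (\<Pi>\<^sub>E i\<in>{..<N}. {0..a})"
      have "L2_set x {..<N} \<le> (\<Sum>i<N. \<bar>x i\<bar>)" by (rule L2_set_le_sum_abs)
      also have "\<dots> \<le> (\<Sum>i<N. a)"
        using x by (intro sum_mono) (auto simp: PiE_iff)
      also have "\<dots> \<le> 1" by (simp add: a_def)
      finally show "x \<in> {x \<in> space (lborel_Rn N). L2_set x {..<N} \<le> 1}"
        using x by (auto simp: space_PiM PiE_iff)
    qed
    have "{x \<in> space (lborel_Rn N). L2_set x {..<N} \<le> 1} \<in> sets (lborel_Rn N)" by measurable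
    then show "{x \<in> space (lborel_Rn N). L2_set x {..<N} \<le> 1} \<in> sets (lborel_Rn N)" .
  qed
  finally show ?thesis .
qed

text \<open>
  The radial distributions of Lebesgue measure on all of $\mathbb{R}^N$ and on a cone are both
  proportional to $r^{N-1}\,dr$, by homogeneity.
\<close>

lemma radial_nn_integral_cone:
  fixes \<rho> :: "real \<Rightarrow> ennreal"
  assumes N: "0 < N" and [measurable]: "B \<in> sets (borel_Rn N)" "\<rho> \<in> borel_measurable borel"
  defines "v \<equiv> \<lambda>B. emeasure (lborel_Rn N) {x \<in> space (lborel_Rn N). kac_proj N x \<in> B \<and> L2_set x {..<N} \<le> 1}"
  shows "v UNIV * (\<integral>\<^sup>+ x. \<rho> (L2_set x {..<N}) * indicator B (kac_proj N x) \<partial>lborel_Rn N)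
      = v B * (\<integral>\<^sup>+ x. \<rho> (L2_set x {..<N}) \<partial>lborel_Rn N)"
proof -
  let ?L = "lborel_Rn N" and ?R = "\<lambda>x. L2_set x {..<N}"
  define w where "w B r = emeasure ?L {x \<in> space ?L. kac_proj N x \<in> B \<and> ?R x \<le> r}" for B r
  define D where "D B = distr (density ?L (\<lambda>x. indicator B (kac_proj N x))) borel ?R" for B
  have spB[measurable]: "space (borel_Rn N) \<in> sets (borel_Rn N)" by simp
  have kp: "kac_proj N x \<in> space (borel_Rn N)" for x
    by (auto simp: kac_proj_def space_PiM)
  have fin: "w B r < \<infinity>" if [measurable]: "B \<in> sets (borel_Rn N)" for B r
  proof -
    have "w B r \<le> emeasure ?L {x \<in> space ?L. ?R x \<le> r}"
      unfolding w_def by (intro emeasure_mono) (auto, measurable)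
    also have "\<dots> < \<infinity>" by (rule emeasure_ball_Rn_finite)
    finally show ?thesis .
  qed
  have sc: "w B (c * r) = ennreal (c ^ N) * w B r" if "0 < c" "B \<in> sets (borel_Rn N)" for B c r
    unfolding w_def by (rule emeasure_cone_ball_scale) fact+
  \<comment> \<open>Halving the radius gives w B 0 = 2^(-N) * w B 0. This finite value must be 0,
    which is where N > 0 enters.\<close>
  have w0: "w B r = 0" if B: "B \<in> sets (borel_Rn N)" and r: "r \<le> 0" for B r
  proof -
    obtain t where t: "w B 0 = ennreal t" "0 \<le> t"
      using fin[OF B, of 0] by (cases "w B 0") auto
    have "w B 0 = ennreal ((1/2) ^ N) * w B 0"
      using sc[of "1/2" B 0] B by simp
    then have "t = (1/2)^N * t"
      using t by (simp add: ennreal_mult[symmetric])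
    moreover have "((1::real)/2)^N < 1" using N by (simp add: power_Suc_less_one power_less_one_iff)
    ultimately have "t = 0" by auto
    then have "w B 0 = 0" using t by simp
    moreover have "w B r \<le> w B 0"
      using r B unfolding w_def by (intro emeasure_mono) (auto, measurable)
    ultimately show ?thesis by simp
  qed
  have hom: "w A 1 * w B r = w B 1 * w A r"
    if "A \<in> sets (borel_Rn N)" "B \<in> sets (borel_Rn N)" for A B r
  proof (cases "0 < r")
    case True
    then show ?thesis using that sc[of r _ 1] by (simp add: ac_simps)
  qed (use w0 that in auto)
  have Demeas: "emeasure (D B) {..r} = w B r" if [measurable]: "B \<in> sets (borel_Rn N)" for B r
  proof -
    have eq: "?R -` {..r} \<inter> space ?L = {x \<in> space ?L. ?R x \<le> r}" by auto
    have [measurable]: "{x \<in> space ?L. ?R x \<le> r} \<in> sets ?L" by measurable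
    have "emeasure (D B) {..r} = (\<integral>\<^sup>+x. indicator B (kac_proj N x) * indicator {x \<in> space ?L. ?R x \<le> r} x \<partial>?L)"
      unfolding D_def by (simp add: emeasure_distr eq emeasure_density)
    also have "\<dots> = (\<integral>\<^sup>+x. indicator {x \<in> space ?L. kac_proj N x \<in> B \<and> ?R x \<le> r} x \<partial>?L)"
      by (intro nn_integral_cong) (auto simp: indicator_def)
    also have "\<dots> = w B r"
      unfolding w_def by (rule nn_integral_indicator) measurable
    finally show ?thesis .
  qed
  \<comment> \<open>After cross-multiplication the two radial measures agree on all half-lines, an
    intersection-stable generator of the Borel sets, and are finite on each of them; hence they are
    equal.\<close>
  have eqD: "density (D B) (\<lambda>_. w (space (borel_Rn N)) 1) = density (D (space (borel_Rn N))) (\<lambda>_. w B 1)"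
  proof (rule measure_eqI_generator_eq[where E="range (\<lambda>a. {..a})" and \<Omega>=UNIV and A="\<lambda>n. {..real n}"])
    show "Int_stable (range (\<lambda>a. {..a::real}))"
      by (auto simp: Int_stable_def intro!: image_eqI[of _ _ "min _ _"])
    show "sets (density (D B) (\<lambda>_. w (space (borel_Rn N)) 1)) = sigma_sets UNIV (range (\<lambda>a. {..a}))"
      "sets (density (D (space (borel_Rn N))) (\<lambda>_. w B 1)) = sigma_sets UNIV (range (\<lambda>a. {..a}))"
      unfolding D_def by (simp_all, simp_all add: borel_eq_atMost)
    show "(\<Union>i. {..real i}) = UNIV" by (auto intro: real_arch_simple)
    have e: "emeasure (density (D A) (\<lambda>_. C)) {..a} = C * w A a" if "A \<in> sets (borel_Rn N)" for A C a
    proof -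
      have "{..a} \<in> sets (D A)" by (simp add: D_def)
      then show ?thesis
        using Demeas[OF that, of a] by (subst emeasure_density) (simp_all add: nn_integral_cmult)
    qed
    show "emeasure (density (D B) (\<lambda>_. w (space (borel_Rn N)) 1)) {..real i} \<noteq> \<infinity>" for i
      using fin by (simp add: e ennreal_mult_eq_top_iff less_top)
    show "emeasure (density (D B) (\<lambda>_. w (space (borel_Rn N)) 1)) X
      = emeasure (density (D (space (borel_Rn N))) (\<lambda>_. w B 1)) X" if "X \<in> range (\<lambda>a. {..a})" for X
      using that hom by (auto simp: e)
  qed auto
  have int: "(\<integral>\<^sup>+r. \<rho> r \<partial>density (D A) (\<lambda>_. C)) = C * (\<integral>\<^sup>+ x. \<rho> (?R x) * indicator A (kac_proj N x) \<partial>?L)"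
    if [measurable]: "A \<in> sets (borel_Rn N)" for A C
  proof -
    have [measurable]: "\<rho> \<in> borel_measurable (D A)" unfolding D_def by simp
    have "(\<integral>\<^sup>+r. \<rho> r \<partial>density (D A) (\<lambda>_. C)) = C * (\<integral>\<^sup>+r. \<rho> r \<partial>D A)"
      by (simp add: nn_integral_density nn_integral_cmult)
    also have "(\<integral>\<^sup>+r. \<rho> r \<partial>D A) = (\<integral>\<^sup>+ x. \<rho> (?R x) * indicator A (kac_proj N x) \<partial>?L)"
      unfolding D_def by (subst nn_integral_distr) (simp_all add: nn_integral_density mult.commute)
    finally show ?thesis .
  qed
  \<comment> \<open>\<open>UNIV\<close> is larger than the space of extensional functions and not
    measurable there; as the projection always lands in that space, the two give the same
    cone.\<close>
  have "w (space (borel_Rn N)) 1 = v UNIV" "w B 1 = v B"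
    using kp by (auto simp: w_def v_def)
  then show ?thesis
    using int[of B "w (space (borel_Rn N)) 1"] int[of "space (borel_Rn N)" "w B 1"] eqD kp by simp
qed

text \<open>At total mass 1, \<open>radial_nn_integral_cone\<close> assigns the cone over B the mass
  v B / v UNIV whatever the radial profile, and this ratio of volumes is the definition of
  \<open>unif_sphere N\<close>. Both the Gaussian and its conditioned versions are
  instances.\<close>

lemma distr_radial_kac_proj:
  fixes \<rho> :: "real \<Rightarrow> ennreal"
  assumes N: "0 < N" and [measurable]: "\<rho> \<in> borel_measurable borel"
    and one: "(\<integral>\<^sup>+ x. \<rho> (L2_set x {..<N}) \<partial>lborel_Rn N) = 1"
  shows "distr (density (lborel_Rn N) (\<lambda>x. \<rho> (L2_set x {..<N}))) (borel_Rn N) (kac_proj N) = unif_sphere N"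
proof (rule measure_eqI)
  show "sets (distr (density (lborel_Rn N) (\<lambda>x. \<rho> (L2_set x {..<N}))) (borel_Rn N) (kac_proj N)) = sets (unif_sphere N)"
    by (simp add: unif_sphere_def)
  fix B assume "B \<in> sets (distr (density (lborel_Rn N) (\<lambda>x. \<rho> (L2_set x {..<N}))) (borel_Rn N) (kac_proj N))"
  then have B[measurable]: "B \<in> sets (borel_Rn N)" by simp
  let ?L = "lborel_Rn N" and ?R = "\<lambda>x. L2_set x {..<N}"
  let ?b = "{x \<in> space ?L. ?R x \<le> 1}"
  define v where "v B = emeasure ?L {x \<in> space ?L. kac_proj N x \<in> B \<and> ?R x \<le> 1}" for B
  have [measurable]: "?b \<in> sets ?L" by measurable
  have pre[measurable]: "kac_proj N -` B \<inter> space ?L \<in> sets ?L" by measurable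
  have "emeasure (distr (density ?L (\<lambda>x. \<rho> (?R x))) (borel_Rn N) (kac_proj N)) B
      = (\<integral>\<^sup>+ x. \<rho> (?R x) * indicator (kac_proj N -` B \<inter> space ?L) x \<partial>?L)"
    by (simp add: emeasure_distr emeasure_density)
  also have "\<dots> = (\<integral>\<^sup>+ x. \<rho> (?R x) * indicator B (kac_proj N x) \<partial>?L)"
    by (intro nn_integral_cong) (auto simp: indicator_def)
  finally have 1: "emeasure (distr (density ?L (\<lambda>x. \<rho> (?R x))) (borel_Rn N) (kac_proj N)) B
    = (\<integral>\<^sup>+ x. \<rho> (?R x) * indicator B (kac_proj N x) \<partial>?L)" .
  have vU: "v UNIV = emeasure ?L ?b" by (simp add: v_def)
  have pos: "v UNIV \<noteq> 0" "v UNIV \<noteq> \<infinity>"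
    using emeasure_ball_Rn_finite[of N 1] emeasure_unit_ball_Rn_pos[of N] by (auto simp: vU)
  have "v UNIV * (\<integral>\<^sup>+ x. \<rho> (?R x) * indicator B (kac_proj N x) \<partial>?L) = v B"
    using radial_nn_integral_cone[OF N B, of \<rho>] one by (simp add: v_def)
  then have 2: "(\<integral>\<^sup>+ x. \<rho> (?R x) * indicator B (kac_proj N x) \<partial>?L) = v B / v UNIV"
    using pos by (metis ennreal_mult_divide_eq mult.commute infinity_ennreal_def)
  have "emeasure (unif_sphere N) B = emeasure (uniform_measure ?L ?b) (kac_proj N -` B \<inter> space ?L)"
    unfolding unif_sphere_def by (subst emeasure_distr) auto
  also have "\<dots> = emeasure ?L (?b \<inter> (kac_proj N -` B \<inter> space ?L)) / v UNIV"
    by (simp add: emeasure_uniform_measure vU)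
  also have "?b \<inter> (kac_proj N -` B \<inter> space ?L) = {x \<in> space ?L. kac_proj N x \<in> B \<and> ?R x \<le> 1}"
    by auto
  finally show "emeasure (distr (density ?L (\<lambda>x. \<rho> (?R x))) (borel_Rn N) (kac_proj N)) B = emeasure (unif_sphere N) B"
    unfolding 1 2 by (simp add: v_def)
qed

section \<open>The Gaussian as a radial measure\<close>

lemma tensor_power_gaussian:
  "tensor_power std_gaussian N
    = density (lborel_Rn N) (\<lambda>x. ennreal ((1 / sqrt (2 * pi)) ^ N * exp (- (L2_set x {..<N})\<^sup>2 / 2)))"
proof -
  interpret G: prob_space std_gaussian by (rule prob_space_normal_density) simp
  have "tensor_power std_gaussian N
      = density (lborel_Rn N) (\<lambda>x. \<Prod>i<N. ennreal (std_normal_density (x i)))"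
  proof (rule PiM_density)
    show "product_sigma_finite (\<lambda>_::nat. lborel :: real measure)" by unfold_locales
    show "product_sigma_finite (\<lambda>_::nat. std_gaussian)" by unfold_locales
  qed auto
  also have "\<dots> = density (lborel_Rn N) (\<lambda>x. ennreal ((1 / sqrt (2 * pi)) ^ N * exp (- (L2_set x {..<N})\<^sup>2 / 2)))"
  proof (rule density_cong)
    have "(\<Prod>i<N. std_normal_density (x i)) = (1 / sqrt (2 * pi)) ^ N * exp (- (L2_set x {..<N})\<^sup>2 / 2)" for x :: "nat \<Rightarrow> real"
      unfolding std_normal_density_def prod.distrib
      by (simp add: L2_set_def sum_nonneg exp_sum[symmetric] sum_negf sum_divide_distrib)
    then show "AE x in lborel_Rn N. (\<Prod>i<N. ennreal (std_normal_density (x i)))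
        = ennreal ((1 / sqrt (2 * pi)) ^ N * exp (- (L2_set x {..<N})\<^sup>2 / 2))"
      by (simp add: prod_ennreal)
  qed measurable
  finally show ?thesis .
qed

text \<open>Restricting the Gaussian to radii in S leaves a radial density, which projects to the
  uniform measure after normalisation. This is the independence of norm and direction, multiplied
  out so that the probability of S may be 0.\<close>

lemma nn_integral_gaussian_kac_proj:
  fixes G :: "(nat \<Rightarrow> real) \<Rightarrow> ennreal"
  assumes N: "0 < N" and [measurable]: "S \<in> sets borel" "G \<in> borel_measurable (borel_Rn N)"
  shows "(\<integral>\<^sup>+ x. G (kac_proj N x) * indicator S (L2_set x {..<N}) \<partial>tensor_power std_gaussian N)
    = emeasure (tensor_power std_gaussian N) {x \<in> space (borel_Rn N). L2_set x {..<N} \<in> S} * (\<integral>\<^sup>+ x. G x \<partial>unif_sphere N)"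
proof -
  let ?R = "\<lambda>x. L2_set x {..<N}" and ?L = "lborel_Rn N" and ?G = "tensor_power std_gaussian N"
  define \<rho> where "\<rho> r = ennreal ((1 / sqrt (2 * pi)) ^ N * exp (- r\<^sup>2 / 2))" for r
  have [measurable]: "\<rho> \<in> borel_measurable borel" unfolding \<rho>_def by measurable
  have G: "?G = density ?L (\<lambda>x. \<rho> (?R x))"
    unfolding \<rho>_def by (rule tensor_power_gaussian)
  interpret PG: prob_space ?G
    by (intro prob_space_PiM prob_space_normal_density) simp
  let ?p = "emeasure ?G {x \<in> space (borel_Rn N). ?R x \<in> S}"
  have sp: "space ?L = space (borel_Rn N)" by (simp add: space_PiM)
  have "?p = (\<integral>\<^sup>+ x. indicator {x \<in> space (borel_Rn N). ?R x \<in> S} x \<partial>?G)"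
    by (subst nn_integral_indicator) (auto simp: G)
  also have "\<dots> = (\<integral>\<^sup>+ x. \<rho> (?R x) * indicator S (?R x) \<partial>?L)"
    unfolding G by (subst nn_integral_density) (auto intro!: nn_integral_cong simp: indicator_def sp)
  finally have p: "?p = (\<integral>\<^sup>+ x. \<rho> (?R x) * indicator S (?R x) \<partial>?L)" .
  have lhs: "(\<integral>\<^sup>+ x. G (kac_proj N x) * indicator S (?R x) \<partial>?G)
      = (\<integral>\<^sup>+ x. \<rho> (?R x) * indicator S (?R x) * G (kac_proj N x) \<partial>?L)"
    unfolding G by (subst nn_integral_density) (auto simp: ac_simps)
  have ptop: "?p \<noteq> \<infinity>" using PG.emeasure_finite by simp
  show ?thesis
  \<comment> \<open>A null set of radii makes both sides 0; otherwise division by \<open>?p\<close>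
    yields the radial probability density of the conditioned Gaussian.\<close>
  proof (cases "?p = 0")
    case True
    then have "AE x in ?L. \<rho> (?R x) * indicator S (?R x) = 0"
      unfolding p by (subst (asm) nn_integral_0_iff_AE) auto
    then have "(\<integral>\<^sup>+ x. \<rho> (?R x) * indicator S (?R x) * G (kac_proj N x) \<partial>?L) = (\<integral>\<^sup>+ x. 0 \<partial>?L)"
      by (intro nn_integral_cong_AE) auto
    with True show ?thesis unfolding lhs by simp
  next
    case False
    define \<rho>' where "\<rho>' r = \<rho> r * indicator S r / ?p" for r
    have [measurable]: "\<rho>' \<in> borel_measurable borel" unfolding \<rho>'_def by measurable
    have "(\<integral>\<^sup>+ x. \<rho>' (?R x) \<partial>?L) = ?p / ?p"
      unfolding \<rho>'_def by (subst nn_integral_divide) (auto simp: p)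
    also have "\<dots> = 1"
      by (rule ennreal_divide_self[OF False]) (use ptop in \<open>simp only: less_top infinity_ennreal_def\<close>)
    finally have one: "(\<integral>\<^sup>+ x. \<rho>' (?R x) \<partial>?L) = 1" .
    have "(\<integral>\<^sup>+ x. G x \<partial>unif_sphere N) = (\<integral>\<^sup>+ x. G (kac_proj N x) \<partial>density ?L (\<lambda>x. \<rho>' (?R x)))"
      unfolding distr_radial_kac_proj[OF N _ one, symmetric, simplified]
      by (subst nn_integral_distr) auto
    also have "\<dots> = (\<integral>\<^sup>+ x. (\<rho> (?R x) * indicator S (?R x) * G (kac_proj N x)) / ?p \<partial>?L)"
      by (subst nn_integral_density) (auto simp: \<rho>'_def ennreal_divide_times ennreal_times_divide mult.commute)
    also have "\<dots> = (\<integral>\<^sup>+ x. \<rho> (?R x) * indicator S (?R x) * G (kac_proj N x) \<partial>?L) / ?p"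
      by (subst nn_integral_divide) auto
    finally show ?thesis
      unfolding lhs using mult_divide_eq_ennreal[OF False ptop[unfolded infinity_ennreal_def]]
      by (simp only: ennreal_times_divide mult.commute)
  qed
qed

lemma distr_gaussian_kac_proj:
  assumes N: "0 < N"
  shows "distr (tensor_power std_gaussian N) (borel_Rn N) (kac_proj N) = unif_sphere N"
proof -
  interpret PG: prob_space "tensor_power std_gaussian N"
    by (intro prob_space_PiM prob_space_normal_density) simp
  have "(\<integral>\<^sup>+ x. ennreal ((1 / sqrt (2 * pi)) ^ N * exp (- (L2_set x {..<N})\<^sup>2 / 2)) \<partial>lborel_Rn N) = 1"
    using PG.emeasure_space_1 unfolding tensor_power_gaussian
    by (simp add: emeasure_density cong: nn_integral_cong)
  from distr_radial_kac_proj[OF N _ this] show ?thesis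
    unfolding tensor_power_gaussian by simp
qed

section \<open>The law of large numbers and chaos\<close>

text \<open>This is nonnegativity of the variance of |X|.\<close>

lemma (in prob_space) expectation_abs_le_sqrt:
  fixes X :: "'a \<Rightarrow> real"
  assumes [measurable]: "X \<in> borel_measurable M" and bd: "\<And>x. \<bar>X x\<bar> \<le> B"
  shows "expectation (\<lambda>x. \<bar>X x\<bar>) \<le> sqrt (expectation (\<lambda>x. (X x)\<^sup>2))"
proof -
  have int: "integrable M (\<lambda>x. \<bar>X x\<bar>)" "integrable M (\<lambda>x. \<bar>X x\<bar>\<^sup>2)"
    by (rule integrable_const_bound[where B=B], use bd in auto)
      (rule integrable_const_bound[where B="B\<^sup>2"],
        use bd in \<open>auto intro!: AE_I2 power_mono[of "\<bar>X _\<bar>" B 2, simplified]\<close>)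
  have "0 \<le> variance (\<lambda>x. \<bar>X x\<bar>)" by (rule variance_positive)
  also have "\<dots> = expectation (\<lambda>x. \<bar>X x\<bar>\<^sup>2) - (expectation (\<lambda>x. \<bar>X x\<bar>))\<^sup>2"
    using int by (rule variance_eq)
  finally show ?thesis by (intro real_le_rsqrt) simp
qed

lemma product_integral_component:
  fixes g :: "'a \<Rightarrow> real"
  assumes \<mu>: "prob_space \<mu>" and i: "i \<in> I" and [measurable]: "g \<in> borel_measurable \<mu>"
  shows "(\<integral>\<omega>. g (\<omega> i) \<partial>PiM I (\<lambda>_. \<mu>)) = (\<integral>x. g x \<partial>\<mu>)"
    and "integrable \<mu> g \<Longrightarrow> integrable (PiM I (\<lambda>_. \<mu>)) (\<lambda>\<omega>. g (\<omega> i))"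
proof -
  have d: "distr (PiM I (\<lambda>_. \<mu>)) \<mu> (\<lambda>\<omega>. \<omega> i) = \<mu>"
    using distr_PiM_component[of I "\<lambda>_. \<mu>" i] \<mu> i by simp
  have [measurable]: "(\<lambda>\<omega>. \<omega> i) \<in> measurable (PiM I (\<lambda>_. \<mu>)) \<mu>"
    using i by measurable
  have "(\<integral>x. g x \<partial>distr (PiM I (\<lambda>_. \<mu>)) \<mu> (\<lambda>\<omega>. \<omega> i)) = (\<integral>\<omega>. g (\<omega> i) \<partial>PiM I (\<lambda>_. \<mu>))"
    by (rule integral_distr) measurable
  then show "(\<integral>\<omega>. g (\<omega> i) \<partial>PiM I (\<lambda>_. \<mu>)) = (\<integral>x. g x \<partial>\<mu>)"
    by (simp add: d)
  have "integrable (distr (PiM I (\<lambda>_. \<mu>)) \<mu> (\<lambda>\<omega>. \<omega> i)) g \<longleftrightarrow> integrable (PiM I (\<lambda>_. \<mu>)) (\<lambda>\<omega>. g (\<omega> i))"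
    by (rule integrable_distr_eq) measurable
  then show "integrable \<mu> g \<Longrightarrow> integrable (PiM I (\<lambda>_. \<mu>)) (\<lambda>\<omega>. g (\<omega> i))"
    by (simp add: d)
qed

text \<open>Projection to the two indices i and j reduces the claim to a finite product, where the
  integral factors.\<close>

lemma product_integral_two_components:
  fixes g :: "'a \<Rightarrow> real"
  assumes \<mu>: "prob_space \<mu>" and i: "i \<in> I" "j \<in> I" "i \<noteq> j" and g: "integrable \<mu> g"
  shows "(\<integral>\<omega>. g (\<omega> i) * g (\<omega> j) \<partial>PiM I (\<lambda>_. \<mu>)) = (\<integral>x. g x \<partial>\<mu>) * (\<integral>x. g x \<partial>\<mu>)"
proof -
  interpret \<mu>: prob_space \<mu> by fact
  interpret P: product_prob_space "\<lambda>_. \<mu>" I by unfold_locales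
  have [measurable]: "g \<in> borel_measurable \<mu>" using g by auto
  have "(\<integral>\<omega>. g (\<omega> i) * g (\<omega> j) \<partial>PiM I (\<lambda>_. \<mu>)) =
      (\<integral>\<omega>. (\<Prod>k\<in>{i,j}. g (restrict \<omega> {i,j} k)) \<partial>PiM I (\<lambda>_. \<mu>))"
    using i by simp
  also have "\<dots> = (\<integral>\<omega>. (\<Prod>k\<in>{i,j}. g (\<omega> k)) \<partial>distr (PiM I (\<lambda>_. \<mu>)) (PiM {i,j} (\<lambda>_. \<mu>)) (\<lambda>\<omega>. restrict \<omega> {i,j}))"
    by (rule integral_distr[symmetric]) (use i in \<open>auto intro!: measurable_restrict_subset simp del: restrict_apply\<close>)
  also have "distr (PiM I (\<lambda>_. \<mu>)) (PiM {i,j} (\<lambda>_. \<mu>)) (\<lambda>\<omega>. restrict \<omega> {i,j}) = PiM {i,j} (\<lambda>_. \<mu>)"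
    using i by (intro P.distr_PiM_restrict_finite) auto
  also have "(\<integral>\<omega>. (\<Prod>k\<in>{i,j}. g (\<omega> k)) \<partial>PiM {i,j} (\<lambda>_. \<mu>)) = (\<Prod>k\<in>{i,j}. \<integral>x. g x \<partial>\<mu>)"
    using g by (intro P.product_integral_prod) auto
  finally show ?thesis using i by simp
qed

text \<open>After centring, the off-diagonal terms of the second moment of the sum vanish by
  independence and the N diagonal terms are at most (2B)^2 each. All N share one infinite product
  space, so that almost sure limits in N make sense later.\<close>

lemma L1_law_of_large_numbers_bounded:
  fixes g :: "'a \<Rightarrow> real"
  assumes \<mu>: "prob_space \<mu>" and g[measurable]: "g \<in> borel_measurable \<mu>" and bd: "\<And>x. \<bar>g x\<bar> \<le> B"
    and N: "0 < N"
  shows "(\<integral>\<omega>. \<bar>(\<Sum>i<N. g (\<omega> i)) / real N - (\<integral>x. g x \<partial>\<mu>)\<bar> \<partial>PiM UNIV (\<lambda>_. \<mu>)) \<le> 2 * B / sqrt (real N)"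
proof -
  interpret \<mu>: prob_space \<mu> by fact
  let ?\<Omega> = "PiM (UNIV :: nat set) (\<lambda>_. \<mu>)"
  interpret \<Omega>: prob_space ?\<Omega> by (rule prob_space_PiM) (rule \<mu>)
  define m where "m = (\<integral>x. g x \<partial>\<mu>)"
  have intg: "integrable \<mu> g"
    by (rule \<mu>.integrable_const_bound[where B=B]) (use bd in auto)
  have "\<bar>m\<bar> \<le> (\<integral>x. \<bar>g x\<bar> \<partial>\<mu>)" unfolding m_def by (rule integral_abs_bound)
  also have "\<dots> \<le> (\<integral>x. B \<partial>\<mu>)"
    using intg bd by (intro integral_mono) auto
  finally have mB: "\<bar>m\<bar> \<le> B" by (simp add: \<mu>.prob_space)
  have B0: "0 \<le> B" using mB by simp
  define Z where "Z x = g x - m" for x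
  have [measurable]: "Z \<in> borel_measurable \<mu>" unfolding Z_def by measurable
  have intZ: "integrable \<mu> Z" unfolding Z_def using intg by auto
  have Z0: "(\<integral>x. Z x \<partial>\<mu>) = 0" unfolding Z_def using intg by (simp add: m_def \<mu>.prob_space)
  have Zbd: "\<bar>Z x\<bar> \<le> 2 * B" for x unfolding Z_def using bd[of x] mB by linarith
  define S where "S \<omega> = (\<Sum>i<N. Z (\<omega> i))" for \<omega>
  have [measurable]: "S \<in> borel_measurable ?\<Omega>" unfolding S_def by measurable
  have Sbd: "\<bar>S \<omega>\<bar> \<le> real N * (2 * B)" for \<omega>
  proof -
    have "\<bar>S \<omega>\<bar> \<le> (\<Sum>i<N. \<bar>Z (\<omega> i)\<bar>)" unfolding S_def by (rule sum_abs)
    also have "\<dots> \<le> (\<Sum>i<N. 2 * B)" by (intro sum_mono Zbd)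
    finally show ?thesis by simp
  qed
  have ZZbd: "\<bar>Z x * Z y\<bar> \<le> (2 * B)\<^sup>2" for x y
    unfolding abs_mult power2_eq_square using Zbd[of x] Zbd[of y] B0 by (intro mult_mono) auto
  have intZZ: "integrable ?\<Omega> (\<lambda>\<omega>. Z (\<omega> i) * Z (\<omega> j))" for i j
    by (rule \<Omega>.integrable_const_bound[where B="(2 * B)\<^sup>2"]) (use ZZbd in auto)
  have ZZ: "(\<integral>\<omega>. Z (\<omega> i) * Z (\<omega> j) \<partial>?\<Omega>) \<le> (if j = i then (2 * B)\<^sup>2 else 0)" for i j
  proof (cases "j = i")
    case True
    have "(\<integral>\<omega>. Z (\<omega> i) * Z (\<omega> i) \<partial>?\<Omega>) \<le> (\<integral>\<omega>. (2 * B)\<^sup>2 \<partial>?\<Omega>)"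
      using ZZbd intZZ by (intro integral_mono) (auto intro: order_trans[OF abs_ge_self])
    then show ?thesis using True by (simp add: \<Omega>.prob_space)
  next
    case False
    then show ?thesis
      using product_integral_two_components[OF \<mu>, of i UNIV j Z] intZ Z0 by simp
  qed
  have "(\<integral>\<omega>. (S \<omega>)\<^sup>2 \<partial>?\<Omega>) = (\<integral>\<omega>. (\<Sum>i<N. \<Sum>j<N. Z (\<omega> i) * Z (\<omega> j)) \<partial>?\<Omega>)"
    unfolding S_def power2_eq_square sum_product ..
  also have "\<dots> = (\<Sum>i<N. \<Sum>j<N. \<integral>\<omega>. Z (\<omega> i) * Z (\<omega> j) \<partial>?\<Omega>)"
    using intZZ by (simp add: Bochner_Integration.integral_sum)
  also have "\<dots> \<le> (\<Sum>i<N. \<Sum>j<N. if j = i then (2 * B)\<^sup>2 else 0)"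
    by (intro sum_mono ZZ)
  also have "\<dots> = real N * (2 * B)\<^sup>2" by (simp add: sum.delta)
  finally have SS: "(\<integral>\<omega>. (S \<omega>)\<^sup>2 \<partial>?\<Omega>) \<le> real N * (2 * B)\<^sup>2" .
  have "(\<integral>\<omega>. \<bar>S \<omega>\<bar> \<partial>?\<Omega>) \<le> sqrt (\<integral>\<omega>. (S \<omega>)\<^sup>2 \<partial>?\<Omega>)"
    by (rule \<Omega>.expectation_abs_le_sqrt[OF _ Sbd]) measurable
  also have "\<dots> \<le> sqrt (real N * (2 * B)\<^sup>2)" using SS by simp
  also have "\<dots> = sqrt (real N) * (2 * B)" using B0 by (simp add: real_sqrt_mult)
  finally have S: "(\<integral>\<omega>. \<bar>S \<omega>\<bar> \<partial>?\<Omega>) \<le> sqrt (real N) * (2 * B)" .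
  have "\<bar>(\<Sum>i<N. g (\<omega> i)) / real N - m\<bar> = \<bar>S \<omega>\<bar> / real N" for \<omega>
  proof -
    have "(\<Sum>i<N. g (\<omega> i)) / real N - m = S \<omega> / real N"
      using N by (simp add: S_def Z_def sum_subtractf field_simps)
    then show ?thesis by simp
  qed
  then have "(\<integral>\<omega>. \<bar>(\<Sum>i<N. g (\<omega> i)) / real N - m\<bar> \<partial>?\<Omega>) = (\<integral>\<omega>. \<bar>S \<omega>\<bar> \<partial>?\<Omega>) / real N"
    by simp
  also have "\<dots> \<le> sqrt (real N) * (2 * B) / real N"
    using S by (intro divide_right_mono) auto
  also have "\<dots> = 2 * B / sqrt (real N)"
    using N by (simp add: field_simps)
  finally show ?thesis by (simp add: m_def)
qed

text \<open>Truncation reduces to bounded functions with an error uniform in N. Plain integrability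
  has to suffice, because for g x = x^2 a variance would require a fourth moment.\<close>

lemma L1_law_of_large_numbers:
  fixes g :: "'a \<Rightarrow> real"
  assumes \<mu>: "prob_space \<mu>" and g: "integrable \<mu> g"
  shows "(\<lambda>N. \<integral>\<omega>. \<bar>(\<Sum>i<N. g (\<omega> i)) / real N - (\<integral>x. g x \<partial>\<mu>)\<bar> \<partial>PiM UNIV (\<lambda>_. \<mu>)) \<longlonglongrightarrow> 0"
proof -
  interpret \<mu>: prob_space \<mu> by fact
  let ?\<Omega> = "PiM (UNIV :: nat set) (\<lambda>_. \<mu>)"
  interpret \<Omega>: prob_space ?\<Omega> by (rule prob_space_PiM) (rule \<mu>)
  have [measurable]: "g \<in> borel_measurable \<mu>" using g by auto
  define t where "t n x = max (- real n) (min (real n) (g x))" for n x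
  have [measurable]: "t n \<in> borel_measurable \<mu>" for n unfolding t_def by measurable
  have tbd: "\<bar>t n x\<bar> \<le> real n" for n x by (auto simp: t_def)
  have tg: "\<bar>t n x\<bar> \<le> \<bar>g x\<bar>" for n x by (auto simp: t_def)
  have intt: "integrable \<mu> (t n)" for n
    by (rule \<mu>.integrable_const_bound[where B="real n"]) (use tbd in auto)
  have "(\<lambda>n. \<integral>x. \<bar>g x - t n x\<bar> \<partial>\<mu>) \<longlonglongrightarrow> (\<integral>x. 0 \<partial>\<mu>)"
  proof (rule integral_dominated_convergence[where w="\<lambda>x. 2 * \<bar>g x\<bar>"])
    show "AE x in \<mu>. (\<lambda>n. \<bar>g x - t n x\<bar>) \<longlonglongrightarrow> 0"
    proof (rule AE_I2)
      fix x
      obtain n0 where "\<bar>g x\<bar> \<le> real n0" using real_arch_simple by blast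
      then have "\<forall>\<^sub>F n in sequentially. \<bar>g x - t n x\<bar> = 0"
        by (intro eventually_sequentiallyI[of n0]) (auto simp: t_def)
      then show "(\<lambda>n. \<bar>g x - t n x\<bar>) \<longlonglongrightarrow> 0" by (rule tendsto_eventually)
    qed
    show "AE x in \<mu>. norm \<bar>g x - t n x\<bar> \<le> 2 * \<bar>g x\<bar>" for n
      using tg[of n] by (intro AE_I2) (smt (verit) real_norm_def)
  qed (use g in auto)
  then have \<delta>: "(\<lambda>n. \<integral>x. \<bar>g x - t n x\<bar> \<partial>\<mu>) \<longlonglongrightarrow> 0" by simp
  let ?a = "\<lambda>h N. \<integral>\<omega>. \<bar>(\<Sum>i<N. h (\<omega> i)) / real N - (\<integral>x. h x \<partial>\<mu>)\<bar> \<partial>?\<Omega>"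
  \<comment> \<open>The truncation error counts twice: once in the empirical mean and once in the
    true mean.\<close>
  have comp: "?a g N \<le> 2 * real n / sqrt (real N) + 2 * (\<integral>x. \<bar>g x - t n x\<bar> \<partial>\<mu>)" if N: "0 < N" for N n
  proof -
    define d where "d = (\<integral>x. \<bar>g x - t n x\<bar> \<partial>\<mu>)"
    have intd: "integrable \<mu> (\<lambda>x. \<bar>g x - t n x\<bar>)" using g intt by auto
    have dm: "\<bar>(\<integral>x. g x \<partial>\<mu>) - (\<integral>x. t n x \<partial>\<mu>)\<bar> \<le> d"
      unfolding d_def using g intt integral_abs_bound[of \<mu> "\<lambda>x. g x - t n x"] by simp
    have i1: "integrable ?\<Omega> (\<lambda>\<omega>. h (\<omega> i))" if "integrable \<mu> h" for h :: "'a \<Rightarrow> real" and i :: nat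
      using product_integral_component(2)[OF \<mu> UNIV_I _ that] that by auto
    have "?a g N \<le> (\<integral>\<omega>. \<bar>(\<Sum>i<N. t n (\<omega> i)) / real N - (\<integral>x. t n x \<partial>\<mu>)\<bar>
        + ((\<Sum>i<N. \<bar>g (\<omega> i) - t n (\<omega> i)\<bar>) / real N + d) \<partial>?\<Omega>)"
    proof (rule integral_mono)
      fix \<omega> :: "nat \<Rightarrow> 'a"
      have "\<bar>(\<Sum>i<N. g (\<omega> i)) / real N - (\<Sum>i<N. t n (\<omega> i)) / real N\<bar>
          = \<bar>\<Sum>i<N. g (\<omega> i) - t n (\<omega> i)\<bar> / real N"
        by (simp add: sum_subtractf diff_divide_distrib[symmetric])
      also have "\<dots> \<le> (\<Sum>i<N. \<bar>g (\<omega> i) - t n (\<omega> i)\<bar>) / real N"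
        by (intro divide_right_mono sum_abs) auto
      finally show "\<bar>(\<Sum>i<N. g (\<omega> i)) / real N - (\<integral>x. g x \<partial>\<mu>)\<bar>
        \<le> \<bar>(\<Sum>i<N. t n (\<omega> i)) / real N - (\<integral>x. t n x \<partial>\<mu>)\<bar>
        + ((\<Sum>i<N. \<bar>g (\<omega> i) - t n (\<omega> i)\<bar>) / real N + d)"
        using dm by linarith
    qed (use g intt intd i1 in \<open>auto intro!: Bochner_Integration.integrable_add Bochner_Integration.integrable_diff integrable_abs integrable_divide Bochner_Integration.integrable_sum\<close>)
    also have "\<dots> = ?a (t n) N + ((\<Sum>i<N. \<integral>\<omega>. \<bar>g (\<omega> i) - t n (\<omega> i)\<bar> \<partial>?\<Omega>) / real N + d)"
      using i1[OF g] i1[OF intt] i1[OF intd] by (simp add: Bochner_Integration.integral_sum \<Omega>.prob_space)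
    also have "(\<Sum>i<N. \<integral>\<omega>. \<bar>g (\<omega> i) - t n (\<omega> i)\<bar> \<partial>?\<Omega>) = (\<Sum>i<N. d)"
      unfolding d_def by (intro sum.cong refl product_integral_component(1)[OF \<mu>]) auto
    also have "?a (t n) N + ((\<Sum>i<N. d) / real N + d) \<le> 2 * real n / sqrt (real N) + 2 * d"
      using L1_law_of_large_numbers_bounded[where g="t n" and B="real n", OF \<mu> _ tbd N] N by simp
    finally show ?thesis by (simp add: d_def)
  qed
  show ?thesis
  proof (rule LIMSEQ_I)
    \<comment> \<open>The truncation level n is fixed before N grows: the doubled truncation error
      stays below e / 2, then the bounded part drops below e / 2.\<close>
    fix e :: real assume e: "0 < e"
    then have "\<forall>\<^sub>F n in sequentially. (\<integral>x. \<bar>g x - t n x\<bar> \<partial>\<mu>) < e / 4"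
      using order_tendstoD(2)[OF \<delta>, of "e/4"] by simp
    then obtain n where n: "(\<integral>x. \<bar>g x - t n x\<bar> \<partial>\<mu>) < e / 4"
      using eventually_happens' sequentially_bot by blast
    have "(\<lambda>N. 2 * real n / sqrt (real N)) \<longlonglongrightarrow> 0"
      by (intro real_tendsto_divide_at_top[of _ "2 * real n"] tendsto_const
          filterlim_compose[OF sqrt_at_top] filterlim_real_sequentially)
    from order_tendstoD(2)[OF this, of "e / 2"]
    have "\<forall>\<^sub>F N in sequentially. 2 * real n / sqrt (real N) < e / 2"
      using e by simp
    with eventually_gt_at_top[of 0] have "\<forall>\<^sub>F N in sequentially. norm (?a g N - 0) < e"
    proof eventually_elim
      case (elim N)
      have "0 \<le> ?a g N" by simp
      then show ?case using comp[of N n] elim n by simp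
    qed
    then show "\<exists>no. \<forall>N\<ge>no. norm (?a g N - 0) < e" by (auto simp: eventually_sequentially)
  qed
qed

section \<open>Weak convergence of the marginals\<close>

text \<open>If convergence failed, the infinitely many indices at distance at least e from l would
  form a subsequence none of whose subsequences converges to l.\<close>

lemma tendsto_subseq_subseq:
  fixes a :: "nat \<Rightarrow> 'a :: metric_space"
  assumes "\<And>r. strict_mono r \<Longrightarrow> \<exists>s. strict_mono (s :: nat \<Rightarrow> nat) \<and> (\<lambda>n. a (r (s n))) \<longlonglongrightarrow> l"
  shows "a \<longlonglongrightarrow> l"
proof (rule ccontr)
  assume "\<not> a \<longlonglongrightarrow> l"
  then obtain e where e: "0 < e" "\<exists>\<^sub>F n in sequentially. e \<le> dist (a n) l"
    by (auto simp: tendsto_iff frequently_def not_less[symmetric])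
  then have inf: "infinite {n. e \<le> dist (a n) l}"
    by (simp add: frequently_cofinite[symmetric] cofinite_eq_sequentially)
  define r where "r = enumerate {n. e \<le> dist (a n) l}"
  have "strict_mono r" unfolding r_def using inf by (rule strict_mono_enumerate)
  then obtain s where s: "(\<lambda>n. a (r (s n))) \<longlonglongrightarrow> l" using assms by blast
  have "\<forall>\<^sub>F n in sequentially. dist (a (r (s n))) l < e"
    using tendstoD[OF s e(1)] .
  moreover have "e \<le> dist (a (r k)) l" for k
    using enumerate_in_set[OF inf, of k] by (simp add: r_def)
  ultimately have "\<forall>\<^sub>F n::nat in sequentially. False"
    by (simp add: not_less[symmetric])
  then show False by simp
qed

text \<open>\<open>top_Rn k\<close> lives on a proper subset of the function type. Composed with
  restriction, \<phi> becomes continuous on all functions, hence Borel; composing further with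
  extension by 0, measurable in each coordinate, recovers \<phi> on
  \<open>space (borel_Rn k)\<close>.\<close>

lemma measurable_continuous_map_top_Rn:
  fixes \<phi> :: "(nat \<Rightarrow> real) \<Rightarrow> real"
  assumes "continuous_map (top_Rn k) euclideanreal \<phi>"
  shows "\<phi> \<in> borel_measurable (borel_Rn k)"
proof -
  have "continuous_map (product_topology (\<lambda>_. euclideanreal) UNIV) (top_Rn k) (\<lambda>x. restrict x {..<k})"
    by (auto simp: continuous_map_componentwise intro!: continuous_map_product_projection)
  from continuous_map_compose[OF this assms]
  have "continuous_on UNIV (\<phi> \<circ> (\<lambda>x. restrict x {..<k}))"
    by (simp add: euclidean_product_topology)
  then have 1: "\<phi> \<circ> (\<lambda>x. restrict x {..<k}) \<in> borel_measurable borel"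
    by (rule borel_measurable_continuous_onI)
  have 2: "(\<lambda>x i. if i < k then x i else 0) \<in> measurable (borel_Rn k) borel"
  proof (rule measurable_coordinatewise_then_product)
    show "(\<lambda>x. if i < k then x i else 0) \<in> borel_measurable (borel_Rn k)" for i
      by (cases "i < k") auto
  qed
  have "(\<phi> \<circ> (\<lambda>x. restrict x {..<k})) \<circ> (\<lambda>x i. if i < k then x i else 0) \<in> borel_measurable (borel_Rn k)"
    using 2 1 by (rule measurable_comp)
  moreover have "((\<phi> \<circ> (\<lambda>x. restrict x {..<k})) \<circ> (\<lambda>x i. if i < k then x i else 0)) x = \<phi> x"
    if "x \<in> space (borel_Rn k)" for x
  proof -
    have "(\<lambda>i\<in>{..<k}. if i < k then x i else 0) = x"
      using that by (auto simp: space_PiM PiE_iff extensional_def fun_eq_iff)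
    then show ?thesis by simp
  qed
  ultimately show ?thesis by (simp cong: measurable_cong)
qed

lemma L2_set_restrict: "L2_set (restrict x {..<N}) {..<N} = L2_set x {..<N}"
  by (rule L2_set_cong) auto

text \<open>The scaling factor is a function of the empirical second moment alone, so the law of
  large numbers for the squares controls it.\<close>

lemma kac_scaling_eq: "sqrt (real N) / L2_set x {..<N} = inverse (sqrt ((\<Sum>i<N. (x i)\<^sup>2) / real N))"
  by (simp add: L2_set_def real_sqrt_divide)

text \<open>
  The second moments converge only in $L^1$; passing to almost surely convergent subsequences makes
  dominated convergence applicable.
\<close>

lemma weak_conv_marginal_kac_pushforward:
  assumes \<mu>: "prob_space \<mu>" and sets[measurable_cong]: "sets \<mu> = sets borel"
    and int: "integrable \<mu> (\<lambda>x. x\<^sup>2)" and one: "(\<integral>x. x\<^sup>2 \<partial>\<mu>) = 1"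
  shows "weak_conv_top (top_Rn k) (\<lambda>N. marginal k (kac_pushforward \<mu> N)) (tensor_power \<mu> k)"
  unfolding weak_conv_top_def
proof (intro allI impI)
  fix \<phi> :: "(nat \<Rightarrow> real) \<Rightarrow> real"
  assume cont: "continuous_map (top_Rn k) euclideanreal \<phi>" and bdd: "bounded (\<phi> ` topspace (top_Rn k))"
  let ?\<Omega> = "PiM (UNIV :: nat set) (\<lambda>_. \<mu>)"
  interpret \<mu>: prob_space \<mu> by fact
  interpret \<Omega>: product_prob_space "\<lambda>_. \<mu>" "UNIV :: nat set" by unfold_locales
  have [measurable]: "\<phi> \<in> borel_measurable (borel_Rn k)"
    using cont by (rule measurable_continuous_map_top_Rn)
  obtain B where "\<forall>y\<in>\<phi> ` topspace (top_Rn k). norm y \<le> B"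
    using bdd unfolding bounded_iff by blast
  then have B: "\<bar>\<phi> x\<bar> \<le> B" if "x \<in> extensional {..<k}" for x
    using that by (auto simp: PiE_iff)
  have setsN[measurable_cong]: "sets (tensor_power \<mu> N) = sets (borel_Rn N)" for N
    by (intro sets_PiM_cong refl sets)
  have dist: "tensor_power \<mu> N = distr ?\<Omega> (tensor_power \<mu> N) (\<lambda>x. restrict x {..<N})" for N
    by (rule \<Omega>.distr_PiM_restrict_finite[symmetric]) auto
  have restr[measurable]: "(\<lambda>x. restrict x {..<N}) \<in> measurable ?\<Omega> (tensor_power \<mu> N)" for N
    by (rule measurable_restrict_subset) auto
  \<comment> \<open>The variables for all N are realised on one infinite product: N enters only
    through the scaling factor, while \<phi> always sees the same k coordinates.\<close>
  define u where "u N \<omega> = \<phi> (\<lambda>i\<in>{..<k}. sqrt (real N) / L2_set \<omega> {..<N} * \<omega> i)" for N \<omega>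
  have L2m[measurable]: "(\<lambda>\<omega>. L2_set \<omega> {..<N}) \<in> borel_measurable ?\<Omega>" for N
    unfolding L2_set_def by measurable
  have [measurable]: "u N \<in> borel_measurable ?\<Omega>" for N
    unfolding u_def by measurable
  have restr': "(\<lambda>x. restrict x {..<k}) \<in> measurable (borel_Rn N) (borel_Rn k)" if "k \<le> N" for N
    using that by (intro measurable_restrict_subset) auto
  have lhs: "(\<integral>x. \<phi> x \<partial>marginal k (kac_pushforward \<mu> N)) = (\<integral>\<omega>. u N \<omega> \<partial>?\<Omega>)" if "k \<le> N" for N
  proof -
    note [measurable] = restr'[OF that]
    have "(\<integral>x. \<phi> x \<partial>marginal k (kac_pushforward \<mu> N))
        = (\<integral>x. \<phi> (restrict (kac_proj N x) {..<k}) \<partial>tensor_power \<mu> N)"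
      unfolding marginal_def kac_pushforward_def by (simp add: integral_distr)
    also have "\<dots> = (\<integral>\<omega>. \<phi> (restrict (kac_proj N (restrict \<omega> {..<N})) {..<k}) \<partial>?\<Omega>)"
      by (subst dist, subst integral_distr) auto
    also have "\<dots> = (\<integral>\<omega>. u N \<omega> \<partial>?\<Omega>)"
      unfolding u_def kac_proj_def L2_set_restrict
      using that by (intro Bochner_Integration.integral_cong arg_cong[of _ _ \<phi>]) (auto simp: restrict_def fun_eq_iff)
    finally show ?thesis .
  qed
  have rhs: "(\<integral>x. \<phi> x \<partial>tensor_power \<mu> k) = (\<integral>\<omega>. \<phi> (restrict \<omega> {..<k}) \<partial>?\<Omega>)"
    by (subst dist, subst integral_distr) auto
  have "(\<lambda>N. \<integral>\<omega>. u N \<omega> \<partial>?\<Omega>) \<longlonglongrightarrow> (\<integral>\<omega>. \<phi> (restrict \<omega> {..<k}) \<partial>?\<Omega>)"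
  proof (rule tendsto_subseq_subseq)
    fix r :: "nat \<Rightarrow> nat" assume r: "strict_mono r"
    define v where "v N \<omega> = (\<Sum>i<N. (\<omega> i)\<^sup>2) / real N - 1" for N and \<omega> :: "nat \<Rightarrow> real"
    have "(\<lambda>N. \<integral>\<omega>. \<bar>v N \<omega>\<bar> \<partial>?\<Omega>) \<longlonglongrightarrow> 0"
      using L1_law_of_large_numbers[OF \<mu> int] unfolding one v_def .
    from LIMSEQ_subseq_LIMSEQ[OF this r]
    have lim: "(\<lambda>n. \<integral>\<omega>. norm (v (r n) \<omega>) \<partial>?\<Omega>) \<longlonglongrightarrow> 0" by (simp add: o_def)
    have "integrable ?\<Omega> (\<lambda>\<omega>. (\<omega> i)\<^sup>2)" for i
      using product_integral_component(2)[OF \<mu> UNIV_I _ int] by simp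
    then have "integrable ?\<Omega> (v N)" for N
      unfolding v_def by (auto intro!: Bochner_Integration.integrable_diff integrable_divide Bochner_Integration.integrable_sum)
    from tendsto_L1_AE_subseq[OF this lim]
    obtain s where s: "strict_mono s" "AE \<omega> in ?\<Omega>. (\<lambda>n. v (r (s n)) \<omega>) \<longlonglongrightarrow> 0" by blast
    have "(\<lambda>n. \<integral>\<omega>. u (r (s n)) \<omega> \<partial>?\<Omega>) \<longlonglongrightarrow> (\<integral>\<omega>. \<phi> (restrict \<omega> {..<k}) \<partial>?\<Omega>)"
    proof (rule integral_dominated_convergence[where w="\<lambda>_. B"])
      show "AE \<omega> in ?\<Omega>. norm (u (r (s n)) \<omega>) \<le> B" for n
        unfolding u_def by (intro AE_I2) (simp add: B)
      show "AE \<omega> in ?\<Omega>. (\<lambda>n. u (r (s n)) \<omega>) \<longlonglongrightarrow> \<phi> (restrict \<omega> {..<k})"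
        using s(2)
      proof eventually_elim
        case (elim \<omega>)
        let ?c = "\<lambda>n. sqrt (real (r (s n))) / L2_set \<omega> {..<r (s n)}"
        \<comment> \<open>The shift \<open>+ 1\<close> undoes the centring in \<open>v\<close>; the
          inverse square root is continuous at the limit 1.\<close>
        have "(\<lambda>n. inverse (sqrt (v (r (s n)) \<omega> + 1))) \<longlonglongrightarrow> inverse (sqrt (0 + 1))"
          using elim by (intro tendsto_intros) auto
        then have c: "?c \<longlonglongrightarrow> 1" unfolding kac_scaling_eq by (simp add: v_def)
        have "limitin (top_Rn k) (\<lambda>n. \<lambda>i\<in>{..<k}. ?c n * \<omega> i) (restrict \<omega> {..<k}) sequentially"
          unfolding limitin_componentwise
        proof (intro conjI ballI)
          fix i assume i: "i \<in> {..<k}"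
          have "(\<lambda>n. ?c n * \<omega> i) \<longlonglongrightarrow> 1 * \<omega> i" by (intro tendsto_intros c)
          then show "limitin euclideanreal (\<lambda>n. (\<lambda>i\<in>{..<k}. ?c n * \<omega> i) i) (restrict \<omega> {..<k} i) sequentially"
            using i by simp
        qed auto
        from continuous_map_limit[OF cont this]
        show ?case by (simp add: u_def o_def)
      qed
    qed auto
    with s(1) show "\<exists>s. strict_mono s \<and> (\<lambda>n. \<integral>\<omega>. u (r (s n)) \<omega> \<partial>?\<Omega>) \<longlonglongrightarrow> (\<integral>\<omega>. \<phi> (restrict \<omega> {..<k}) \<partial>?\<Omega>)"
      by blast
  qed
  then show "(\<lambda>N. \<integral>x. \<phi> x \<partial>marginal k (kac_pushforward \<mu> N)) \<longlonglongrightarrow> (\<integral>x. \<phi> x \<partial>tensor_power \<mu> k)"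
    unfolding rhs by (rule Lim_transform_eventually)
      (auto intro!: eventually_sequentiallyI[of k] simp: lhs)
qed

section \<open>Permutation symmetry\<close>

lemma prob_space_kac_pushforward:
  assumes "prob_space \<mu>" "sets \<mu> = sets borel"
  shows "prob_space (kac_pushforward \<mu> N)"
proof -
  have [measurable_cong]: "sets (tensor_power \<mu> N) = sets (borel_Rn N)"
    by (intro sets_PiM_cong) (auto simp: assms)
  show ?thesis
    unfolding kac_pushforward_def
    by (intro prob_space.prob_space_distr prob_space_PiM assms) measurable
qed

lemma kac_proj_permute:
  assumes p: "p permutes {..<N}"
  shows "kac_proj N x \<circ> p = kac_proj N (\<lambda>i\<in>{..<N}. x (p i))"
proof -
  have "L2_set (\<lambda>i\<in>{..<N}. x (p i)) {..<N} = L2_set x {..<N}"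
    unfolding L2_set_def using sum.permute[OF p, of "\<lambda>i. (x i)\<^sup>2"] by (simp add: o_def)
  moreover have "p i < N \<longleftrightarrow> i < N" for i
    using permutes_in_image[OF p, of i] by simp
  ultimately show ?thesis
    by (auto simp: kac_proj_def fun_eq_iff restrict_def)
qed

text \<open>The norm is permutation invariant, so the projection commutes with permuting
  coordinates, and the product measure is exchangeable.\<close>

lemma sym_prob_kac_pushforward:
  assumes \<mu>: "prob_space \<mu>" and sets: "sets \<mu> = sets borel"
  shows "sym_prob N (kac_pushforward \<mu> N)"
  unfolding sym_prob_def
proof (intro conjI allI impI)
  show "prob_space (kac_pushforward \<mu> N)" by (rule prob_space_kac_pushforward) fact+
  show "sets (kac_pushforward \<mu> N) = sets (borel_Rn N)" by (simp add: kac_pushforward_def)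
  fix p assume p: "p permutes {..<N}"
  have setsN[measurable_cong]: "sets (tensor_power \<mu> N) = sets (borel_Rn N)"
    by (intro sets_PiM_cong) (auto simp: sets)
  have pN: "p i < N \<longleftrightarrow> i < N" for i
    using permutes_in_image[OF p, of i] by simp
  have [measurable]: "(\<lambda>x. \<lambda>i\<in>{..<N}. x (p i)) \<in> measurable (borel_Rn N) (borel_Rn N)"
    using pN by (intro measurable_restrict) (auto intro!: measurable_component_singleton)
  have comp: "x \<circ> p = (\<lambda>i\<in>{..<N}. x (p i))" if "x \<in> space (borel_Rn N)" for x
    using that pN by (auto simp: space_PiM PiE_iff extensional_def fun_eq_iff restrict_def)
  have pm[measurable]: "(\<lambda>x. x \<circ> p) \<in> measurable (borel_Rn N) (borel_Rn N)"
    by (subst measurable_cong[OF comp]) measurable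
  have "distr (tensor_power \<mu> N) (tensor_power \<mu> N) (\<lambda>x. \<lambda>i\<in>{..<N}. x (p i)) = tensor_power \<mu> N"
    using distr_PiM_reindex[of "{..<N}" "\<lambda>_. \<mu>" p "{..<N}"] \<mu> permutes_inj_on[OF p] pN
    by (auto simp: Pi_iff)
  then have reidx: "distr (tensor_power \<mu> N) (borel_Rn N) (\<lambda>x. \<lambda>i\<in>{..<N}. x (p i)) = tensor_power \<mu> N"
    using setsN by (simp cong: distr_cong)
  have "distr (kac_pushforward \<mu> N) (borel_Rn N) (\<lambda>x. x \<circ> p)
      = distr (tensor_power \<mu> N) (borel_Rn N) ((\<lambda>x. x \<circ> p) \<circ> kac_proj N)"
    unfolding kac_pushforward_def by (rule distr_distr) measurable
  also have "(\<lambda>x. x \<circ> p) \<circ> kac_proj N = kac_proj N \<circ> (\<lambda>x. \<lambda>i\<in>{..<N}. x (p i))"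
    using kac_proj_permute[OF p] by (simp add: fun_eq_iff)
  also have "distr (tensor_power \<mu> N) (borel_Rn N) (kac_proj N \<circ> (\<lambda>x. \<lambda>i\<in>{..<N}. x (p i)))
    = distr (distr (tensor_power \<mu> N) (borel_Rn N) (\<lambda>x. \<lambda>i\<in>{..<N}. x (p i))) (borel_Rn N) (kac_proj N)"
    by (rule distr_distr[symmetric]) measurable
  also have "\<dots> = kac_pushforward \<mu> N"
    unfolding reidx kac_pushforward_def ..
  finally show "distr (kac_pushforward \<mu> N) (borel_Rn N) (\<lambda>x. x \<circ> p) = kac_pushforward \<mu> N" .
qed

section \<open>Entropy of the projected product measures\<close>

lemma absolutely_continuous_distr:
  assumes ac: "absolutely_continuous M N" and sets[measurable_cong]: "sets N = sets M"
    and T[measurable]: "T \<in> measurable M K"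
  shows "absolutely_continuous (distr M K T) (distr N K T)"
  unfolding absolutely_continuous_def
proof
  fix A assume A: "A \<in> null_sets (distr M K T)"
  have T': "T \<in> measurable N K" by measurable
  have "T -` A \<inter> space M \<in> null_sets M" "A \<in> sets K"
    using A null_sets_distr_iff[OF T] by auto
  then have "T -` A \<inter> space N \<in> null_sets N"
    using ac sets_eq_imp_space_eq[OF sets] by (auto simp: absolutely_continuous_def)
  then show "A \<in> null_sets (distr N K T)"
    using \<open>A \<in> sets K\<close> null_sets_distr_iff[OF T'] by auto
qed

lemma prob_space_std_gaussian: "prob_space std_gaussian"
  by (rule prob_space_normal_density) simp

lemma prob_space_unif_sphere: "0 < N \<Longrightarrow> prob_space (unif_sphere N)"
  by (subst distr_gaussian_kac_proj[symmetric])
    (auto intro!: prob_space.prob_space_distr prob_space_PiM prob_space_std_gaussian)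

lemma tensor_power_density_gaussian:
  fixes h :: "real \<Rightarrow> real"
  assumes [measurable]: "h \<in> borel_measurable borel" and h0: "\<And>x. 0 \<le> h x"
    and prob: "prob_space (density std_gaussian (\<lambda>x. ennreal (h x)))"
  shows "tensor_power (density std_gaussian (\<lambda>x. ennreal (h x))) N
    = density (tensor_power std_gaussian N) (\<lambda>x. ennreal (\<Prod>i<N. h (x i)))"
proof -
  interpret G: prob_space std_gaussian by (rule prob_space_std_gaussian)
  interpret P: prob_space "density std_gaussian (\<lambda>x. ennreal (h x))" by fact
  have "tensor_power (density std_gaussian (\<lambda>x. ennreal (h x))) N
    = density (tensor_power std_gaussian N) (\<lambda>x. \<Prod>i<N. ennreal (h (x i)))"
  proof (rule PiM_density)
    show "product_sigma_finite (\<lambda>_::nat. std_gaussian)" by unfold_locales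
    show "product_sigma_finite (\<lambda>_::nat. density std_gaussian (\<lambda>x. ennreal (h x)))" by unfold_locales
  qed auto
  then show ?thesis by (simp add: prod_ennreal h0)
qed

text \<open>Before projection the product density is explicit, and absolute continuity survives a
  common push-forward. Both halves of the variational formula assume it.\<close>

lemma kac_pushforward_absolutely_continuous:
  fixes h :: "real \<Rightarrow> real"
  assumes N: "0 < N" and [measurable]: "h \<in> borel_measurable borel" and h0: "\<And>x. 0 \<le> h x"
    and \<mu>: "\<mu> = density std_gaussian (\<lambda>x. ennreal (h x))" and prob: "prob_space \<mu>"
  shows "absolutely_continuous (unif_sphere N) (kac_pushforward \<mu> N)"
proof -
  have eq: "tensor_power \<mu> N = density (tensor_power std_gaussian N) (\<lambda>x. ennreal (\<Prod>i<N. h (x i)))"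
    unfolding \<mu> by (intro tensor_power_density_gaussian h0 prob[unfolded \<mu>]) measurable
  have "absolutely_continuous (tensor_power std_gaussian N) (tensor_power \<mu> N)"
    unfolding eq by (rule absolutely_continuousI_density) measurable
  then show ?thesis
    unfolding kac_pushforward_def distr_gaussian_kac_proj[OF N, symmetric]
    by (rule absolutely_continuous_distr) (auto simp: eq)
qed

text \<open>
  The data processing inequality for $x\mapsto\hat x$, which maps the Gaussian measure to the uniform
  one, is read off from the variational formula: test functions on the sphere pull back.
\<close>

lemma rel_entropy_kac_pushforward_le:
  fixes h :: "real \<Rightarrow> real"
  assumes N: "0 < N" and [measurable]: "h \<in> borel_measurable borel" and h0: "\<And>x. 0 \<le> h x"
    and \<mu>: "\<mu> = density std_gaussian (\<lambda>x. ennreal (h x))" and prob: "prob_space \<mu>"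
    and int: "integrable \<mu> (\<lambda>x. ln (h x))"
  shows "rel_entropy (kac_pushforward \<mu> N) (unif_sphere N) \<le> ereal (real N * (\<integral>x. ln (h x) \<partial>\<mu>))"
proof (rule rel_entropy_le_Donsker_Varadhan)
  let ?G = "tensor_power std_gaussian N" and ?P = "tensor_power \<mu> N"
  have sets[measurable_cong]: "sets \<mu> = sets borel" by (simp add: \<mu>)
  show "prob_space (unif_sphere N)" using N by (rule prob_space_unif_sphere)
  show "prob_space (kac_pushforward \<mu> N)" by (rule prob_space_kac_pushforward) fact+
  show "absolutely_continuous (unif_sphere N) (kac_pushforward \<mu> N)"
    by (rule kac_pushforward_absolutely_continuous) fact+
  show "sets (kac_pushforward \<mu> N) = sets (unif_sphere N)"
    by (simp add: kac_pushforward_def unif_sphere_def)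
  fix \<Phi> :: "(nat \<Rightarrow> real) \<Rightarrow> real" and B
  assume "\<Phi> \<in> borel_measurable (unif_sphere N)" and bd: "\<And>x. \<bar>\<Phi> x\<bar> \<le> B"
  then have [measurable]: "\<Phi> \<in> borel_measurable (borel_Rn N)" by (simp add: unif_sphere_def)
  have setsP[measurable_cong]: "sets ?P = sets (borel_Rn N)"
    by (intro sets_PiM_cong refl sets)
  have setsG[measurable_cong]: "sets ?G = sets (borel_Rn N)"
    by (intro sets_PiM_cong) auto
  have eq: "?P = density ?G (\<lambda>x. ennreal (\<Prod>i<N. h (x i)))"
    unfolding \<mu> by (intro tensor_power_density_gaussian h0 prob[unfolded \<mu>]) measurable
  have intL: "integrable ?P (\<lambda>x. ln (h (x i)))" "(\<integral>x. ln (h (x i)) \<partial>?P) = (\<integral>x. ln (h x) \<partial>\<mu>)"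
    if "i < N" for i
  proof -
    have i: "i \<in> {..<N}" using that by simp
    have m: "(\<lambda>x. ln (h x)) \<in> borel_measurable \<mu>" by measurable
    show "integrable ?P (\<lambda>x. ln (h (x i)))" "(\<integral>x. ln (h (x i)) \<partial>?P) = (\<integral>x. ln (h x) \<partial>\<mu>)"
      using product_integral_component[OF prob i m] int by simp_all
  qed
  have "(\<integral>x. \<Phi> (kac_proj N x) \<partial>?P) - ln (\<integral>x. exp (\<Phi> (kac_proj N x)) \<partial>?G)
      \<le> (\<integral>x. (\<Sum>i<N. ln (h (x i))) \<partial>?P)"
  \<comment> \<open>The log-density is taken as the sum of the ln (h (x i)), which can be integrated
    coordinate by coordinate. Its exponential is the product only where all factors are positive,
    which holds almost surely under \<open>?P\<close>.\<close>
  proof (rule Gibbs_variational[OF _ _ _ _ eq])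
    show "prob_space ?G" by (intro prob_space_PiM prob_space_std_gaussian)
    show "prob_space ?P" by (intro prob_space_PiM prob)
    show "(\<lambda>x. \<Prod>i<N. h (x i)) \<in> borel_measurable ?G" by measurable
    show "(\<lambda>x. \<Phi> (kac_proj N x)) \<in> borel_measurable ?G" by measurable
    show "0 \<le> (\<Prod>i<N. h (x i))" for x by (intro prod_nonneg) (simp add: h0)
    show "\<bar>\<Phi> (kac_proj N x)\<bar> \<le> B" for x by (rule bd)
    show "integrable ?P (\<lambda>x. \<Sum>i<N. ln (h (x i)))"
      using intL(1) by (intro Bochner_Integration.integrable_sum) auto
    have "AE x in \<mu>. 0 < h x"
      unfolding \<mu> by (subst AE_density) auto
    then have "AE x in ?P. 0 < h (x i)" if "i < N" for i
      using that prob by (intro AE_PiM_component) auto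
    then have "AE x in ?P. \<forall>i\<in>{..<N}. 0 < h (x i)"
      by (intro AE_finite_allI) auto
    then show "AE x in ?P. (\<Prod>i<N. h (x i)) = exp (\<Sum>i<N. ln (h (x i)))"
      by eventually_elim (simp add: exp_sum)
  qed
  also have "\<dots> = real N * (\<integral>x. ln (h x) \<partial>\<mu>)"
    using intL by (subst Bochner_Integration.integral_sum) auto
  finally show "(\<integral>x. \<Phi> x \<partial>kac_pushforward \<mu> N) - ln (\<integral>x. exp (\<Phi> x) \<partial>unif_sphere N)
      \<le> real N * (\<integral>x. ln (h x) \<partial>\<mu>)"
    unfolding kac_pushforward_def distr_gaussian_kac_proj[OF N, symmetric]
    by (subst (1 2) integral_distr) auto
qed

section \<open>Exponential integrals over the sphere\<close>

lemma std_gaussian_second_moment: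
  "integrable std_gaussian (\<lambda>x. x\<^sup>2)" "(\<integral>x. x\<^sup>2 \<partial>std_gaussian) = 1"
  using std_normal_moment_even[of 1]
  by (simp_all add: integrable_density integral_density has_bochner_integral_iff)

text \<open>Markov's inequality applied to the L1 law of large numbers for the squares. Any positive
  constant would do in place of 1/2, since only its logarithm divided by N matters.\<close>

lemma gaussian_norm_concentration:
  assumes \<delta>: "0 < \<delta>"
  shows "\<forall>\<^sub>F N in sequentially. ennreal (1/2) \<le>
    emeasure (tensor_power std_gaussian N) {x \<in> space (borel_Rn N). \<bar>(L2_set x {..<N})\<^sup>2 / real N - 1\<bar> \<le> \<delta>}"
proof -
  let ?\<Omega> = "PiM (UNIV :: nat set) (\<lambda>_. std_gaussian)"
  interpret G: prob_space std_gaussian by (rule prob_space_std_gaussian)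
  interpret \<Omega>: product_prob_space "\<lambda>_. std_gaussian" "UNIV :: nat set" by unfold_locales
  define v where "v N \<omega> = \<bar>(\<Sum>i<N. (\<omega> i)\<^sup>2) / real N - 1\<bar>" for N and \<omega> :: "nat \<Rightarrow> real"
  have "(\<lambda>N. \<integral>\<omega>. v N \<omega> \<partial>?\<Omega>) \<longlonglongrightarrow> 0"
    using L1_law_of_large_numbers[OF prob_space_std_gaussian std_gaussian_second_moment(1)]
    unfolding std_gaussian_second_moment(2) v_def .
  from order_tendstoD(2)[OF this, of "\<delta> / 2"] \<delta>
  have "\<forall>\<^sub>F N in sequentially. (\<integral>\<omega>. v N \<omega> \<partial>?\<Omega>) < \<delta> / 2" by simp
  then show ?thesis
  proof eventually_elim
    case (elim N)
    let ?A = "{x \<in> space (borel_Rn N). \<bar>(L2_set x {..<N})\<^sup>2 / real N - 1\<bar> \<le> \<delta>}"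
    have [measurable]: "v N \<in> borel_measurable ?\<Omega>" unfolding v_def by measurable
    have setsN[measurable_cong]: "sets (tensor_power std_gaussian N) = sets (borel_Rn N)"
      by (intro sets_PiM_cong) auto
    have restr[measurable]: "(\<lambda>x. restrict x {..<N}) \<in> measurable ?\<Omega> (tensor_power std_gaussian N)"
      by (rule measurable_restrict_subset) auto
    have A: "?A \<in> sets (tensor_power std_gaussian N)" by measurable
    have "integrable ?\<Omega> (\<lambda>\<omega>. (\<omega> i)\<^sup>2)" for i
      using product_integral_component(2)[OF prob_space_std_gaussian UNIV_I _ std_gaussian_second_moment(1)] by simp
    then have intv: "integrable ?\<Omega> (v N)"
      unfolding v_def by (auto intro!: integrable_abs Bochner_Integration.integrable_diff integrable_divide Bochner_Integration.integrable_sum)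
    have "\<P>(\<omega> in ?\<Omega>. v N \<omega> \<ge> \<delta>) \<le> (\<integral>\<omega>. v N \<omega> \<partial>?\<Omega>) / \<delta>"
      using integral_Markov_inequality_measure[OF intv _ _ \<delta>, of "space ?\<Omega>"] by (simp add: v_def)
    also have "\<dots> \<le> 1 / 2" using elim \<delta> by (simp add: divide_le_eq)
    finally have "1 / 2 \<le> 1 - \<P>(\<omega> in ?\<Omega>. v N \<omega> \<ge> \<delta>)" by simp
    also have "\<dots> = \<P>(\<omega> in ?\<Omega>. \<not> v N \<omega> \<ge> \<delta>)"
      by (rule \<Omega>.prob_neg[symmetric]) measurable
    also have "\<dots> \<le> \<P>(\<omega> in ?\<Omega>. v N \<omega> \<le> \<delta>)"
      by (intro \<Omega>.finite_measure_mono) auto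
    finally have "ennreal (1/2) \<le> emeasure ?\<Omega> {\<omega> \<in> space ?\<Omega>. v N \<omega> \<le> \<delta>}"
      unfolding \<Omega>.emeasure_eq_measure by (rule ennreal_leI)
    also have "{\<omega> \<in> space ?\<Omega>. v N \<omega> \<le> \<delta>} = (\<lambda>x. restrict x {..<N}) -` ?A \<inter> space ?\<Omega>"
      by (auto simp: v_def space_PiM L2_set_restrict L2_set_def sum_nonneg)
    also have "emeasure ?\<Omega> \<dots> = emeasure (distr ?\<Omega> (tensor_power std_gaussian N) (\<lambda>x. restrict x {..<N})) ?A"
      by (rule emeasure_distr[symmetric, OF restr A])
    also have "distr ?\<Omega> (tensor_power std_gaussian N) (\<lambda>x. restrict x {..<N}) = tensor_power std_gaussian N"
      by (rule \<Omega>.distr_PiM_restrict_finite) auto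
    finally show ?case .
  qed
qed

text \<open>
  With $s = \sqrt N / |x|$, the left-hand side is $|s - 1| \sum_i |x_i| \le |s - 1| \sqrt N |x|
  = \sqrt N\, |\sqrt N - |x||$.
\<close>

lemma sum_abs_kac_proj_diff_le:
  assumes N: "0 < N" and \<delta>: "\<bar>(L2_set x {..<N})\<^sup>2 / real N - 1\<bar> \<le> \<delta>" "\<delta> < 1"
  shows "(\<Sum>i<N. \<bar>kac_proj N x i - x i\<bar>) \<le> \<delta> * real N"
proof -
  let ?R = "L2_set x {..<N}" and ?n = "sqrt (real N)"
  have n: "0 < ?n" "?n * ?n = real N" using N by simp_all
  have R0: "0 \<le> ?R" by simp
  \<comment> \<open>At norm 0 the deviation from 1 would be exactly 1, which \<delta> < 1
    excludes.\<close>
  have "?R \<noteq> 0" using \<delta> by auto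
  then have R: "0 < ?R" using R0 by linarith
  have "(\<Sum>i<N. \<bar>x i\<bar>) = (\<Sum>i<N. \<bar>x i\<bar> * \<bar>1\<bar>)" by simp
  also have "\<dots> \<le> ?R * L2_set (\<lambda>_. 1) {..<N}" by (rule L2_set_mult_ineq)
  also have "L2_set (\<lambda>_. 1) {..<N} = ?n" by (simp add: L2_set_def)
  finally have CS: "(\<Sum>i<N. \<bar>x i\<bar>) \<le> ?R * ?n" .
  have "(\<Sum>i<N. \<bar>kac_proj N x i - x i\<bar>) = (\<Sum>i<N. \<bar>?n / ?R - 1\<bar> * \<bar>x i\<bar>)"
    by (intro sum.cong refl) (simp add: kac_proj_def abs_mult[symmetric] algebra_simps)
  also have "\<dots> = \<bar>?n / ?R - 1\<bar> * (\<Sum>i<N. \<bar>x i\<bar>)" by (simp add: sum_distrib_left)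
  also have "\<dots> \<le> \<bar>?n / ?R - 1\<bar> * (?R * ?n)" by (intro mult_left_mono CS) auto
  also have "\<dots> = \<bar>(?n / ?R - 1) * ?R\<bar> * ?n" using R by (simp add: abs_mult)
  also have "(?n / ?R - 1) * ?R = ?n - ?R" using R by (simp add: field_simps)
  \<comment> \<open>Enlarging \<open>?n\<close> to \<open>?n + ?R\<close> completes the difference
    of squares, which is the quantity bounded by the hypothesis.\<close>
  also have "\<bar>?n - ?R\<bar> * ?n \<le> \<bar>?n - ?R\<bar> * (?n + ?R)"
    using R by (intro mult_left_mono) auto
  also have "\<dots> = \<bar>(?n - ?R) * (?n + ?R)\<bar>" using R n by (simp add: abs_mult)
  also have "(?n - ?R) * (?n + ?R) = real N - ?R\<^sup>2"
    using n by (simp add: algebra_simps power2_eq_square)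
  also have "\<bar>real N - ?R\<^sup>2\<bar> = \<bar>?R\<^sup>2 / real N - 1\<bar> * real N"
  proof -
    have "real N - ?R\<^sup>2 = - ((?R\<^sup>2 / real N - 1) * real N)" using N by (simp add: field_simps)
    then show ?thesis by (simp add: abs_mult)
  qed
  also have "\<dots> \<le> \<delta> * real N" using \<delta> by (intro mult_right_mono) auto
  finally show ?thesis .
qed

text \<open>Nearby points are handled by uniform continuity, distant ones by a slope steep enough to
  absorb the total oscillation 2M. An affine bound can be summed over coordinates, so only the l1
  distance between a point and its projection is needed.\<close>

lemma uniformly_continuous_bounded_affine:
  fixes \<phi> :: "real \<Rightarrow> real"
  assumes uc: "uniformly_continuous_on UNIV \<phi>" and bd: "\<And>x. \<bar>\<phi> x\<bar> \<le> M" and e: "0 < e"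
  obtains K where "0 < K" "\<And>x y. \<phi> x \<le> \<phi> y + e + K * \<bar>x - y\<bar>"
proof -
  obtain d where d: "0 < d" "\<And>x y. \<bar>x - y\<bar> < d \<Longrightarrow> \<bar>\<phi> x - \<phi> y\<bar> < e"
    using uc e unfolding uniformly_continuous_on_def dist_real_def by (metis UNIV_I)
  have M: "0 \<le> M" using bd[of 0] by linarith
  \<comment> \<open>At distance d the slope already gains more than 2M; the extra 1 keeps K positive
    when M = 0.\<close>
  define K where "K = (2 * M + 1) / d"
  have K: "0 < K" using M d by (simp add: K_def)
  have "\<phi> x \<le> \<phi> y + e + K * \<bar>x - y\<bar>" for x y
  proof (cases "\<bar>x - y\<bar> < d")
    case True
    then show ?thesis using d(2)[of x y] K by (smt (verit) mult_nonneg_nonneg)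
  next
    case False
    then have "K * d \<le> K * \<bar>x - y\<bar>" using K by (intro mult_left_mono) auto
    moreover have "K * d = 2 * M + 1" using d by (simp add: K_def)
    ultimately show ?thesis using bd[of x] bd[of y] e by (simp add: abs_le_iff)
  qed
  with K show ?thesis by (rule that)
qed

text \<open>
  Replace the uniform measure on the sphere by the Gaussian measure conditioned on $|x|^2 \approx N$,
  where $\hat x$ is close to $x$, and drop the conditioning, which costs a factor of at most 2.
\<close>

lemma ln_integral_exp_unif_sphere_le:
  fixes \<phi> :: "real \<Rightarrow> real"
  assumes uc: "uniformly_continuous_on UNIV \<phi>" and bd: "\<And>x. \<bar>\<phi> x\<bar> \<le> M" and e: "0 < e"
  shows "\<forall>\<^sub>F N in sequentially. ln (\<integral>x. exp (\<Sum>i<N. \<phi> (x i)) \<partial>unif_sphere N)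
    \<le> real N * (ln (\<integral>x. exp (\<phi> x) \<partial>std_gaussian) + e)"
proof -
  interpret G: prob_space std_gaussian by (rule prob_space_std_gaussian)
  interpret PG: product_sigma_finite "\<lambda>_::nat. std_gaussian" by unfold_locales
  have [measurable]: "\<phi> \<in> borel_measurable borel"
    using uc by (intro borel_measurable_continuous_onI uniformly_continuous_imp_continuous)
  obtain K where K: "0 < K" "\<And>x y. \<phi> x \<le> \<phi> y + e / 4 + K * \<bar>x - y\<bar>"
    using uniformly_continuous_bounded_affine[OF uc bd, of "e / 4"] e by auto
  \<comment> \<open>The bound 1/2 gives \<delta> < 1, as \<open>sum_abs_kac_proj_diff_le\<close>
    requires; the other gives K * \<delta> \<le> e / 4. With the e / 4 of the affine estimate this
    spends e / 2 per coordinate.\<close>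
  define \<delta> where "\<delta> = min (1/2) (e / (4 * K))"
  have \<delta>: "0 < \<delta>" "\<delta> < 1" "K * \<delta> \<le> e / 4"
  proof -
    show "0 < \<delta>" "\<delta> < 1" using e K by (simp_all add: \<delta>_def)
    have "K * \<delta> \<le> K * (e / (4 * K))" using K by (intro mult_left_mono) (auto simp: \<delta>_def)
    then show "K * \<delta> \<le> e / 4" using K by simp
  qed
  define I where "I = (\<integral>x. exp (\<phi> x) \<partial>std_gaussian)"
  have intexp: "integrable std_gaussian (\<lambda>x. exp (\<phi> x))" and I: "0 < I"
    unfolding I_def using G.integral_exp_bounded[OF _ bd] by auto
  have nnI: "(\<integral>\<^sup>+x. ennreal (exp (\<phi> x)) \<partial>std_gaussian) = ennreal I"
    unfolding I_def using intexp by (intro nn_integral_eq_integral) auto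
  \<comment> \<open>From here on ln 2 \<le> N * e / 2, so the factor 2 uses up the other half of
    e.\<close>
  have "\<forall>\<^sub>F N in sequentially. 2 * ln 2 / e \<le> real N"
    using filterlim_real_sequentially by (auto simp: filterlim_at_top)
  with gaussian_norm_concentration[OF \<delta>(1)] eventually_gt_at_top[of 0]
  show ?thesis
  proof eventually_elim
    case (elim N)
    let ?G = "tensor_power std_gaussian N"
    let ?A = "{x \<in> space (borel_Rn N). \<bar>(L2_set x {..<N})\<^sup>2 / real N - 1\<bar> \<le> \<delta>}"
    define S where "S = {r. \<bar>r\<^sup>2 / real N - 1\<bar> \<le> \<delta>}"
    have [measurable]: "S \<in> sets borel" unfolding S_def by measurable
    have N: "0 < N" by fact
    interpret U: prob_space "unif_sphere N" using N by (rule prob_space_unif_sphere)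
    have [measurable]: "(\<lambda>x. \<Sum>i<N. \<phi> (x i)) \<in> borel_measurable (borel_Rn N)" by measurable
    have setsU[measurable_cong]: "sets (unif_sphere N) = sets (borel_Rn N)" by (simp add: unif_sphere_def)
    have setsG[measurable_cong]: "sets ?G = sets (borel_Rn N)"
      by (intro sets_PiM_cong) auto
    define J where "J = (\<integral>x. exp (\<Sum>i<N. \<phi> (x i)) \<partial>unif_sphere N)"
    have Sbd: "\<bar>\<Sum>i<N. \<phi> (x i)\<bar> \<le> real N * M" for x
    proof -
      have "\<bar>\<Sum>i<N. \<phi> (x i)\<bar> \<le> (\<Sum>i<N. \<bar>\<phi> (x i)\<bar>)" by (rule sum_abs)
      also have "\<dots> \<le> (\<Sum>i<N. M)" by (intro sum_mono bd)
      finally show ?thesis by simp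
    qed
    have intJ: "integrable (unif_sphere N) (\<lambda>x. exp (\<Sum>i<N. \<phi> (x i)))" and J: "0 < J"
      unfolding J_def by (rule U.integral_exp_bounded[OF _ Sbd], measurable)+
    have nnJ: "(\<integral>\<^sup>+x. ennreal (exp (\<Sum>i<N. \<phi> (x i))) \<partial>unif_sphere N) = ennreal J"
      unfolding J_def using intJ by (intro nn_integral_eq_integral) auto
    have bound: "(\<Sum>i<N. \<phi> (kac_proj N x i)) \<le> (\<Sum>i<N. \<phi> (x i)) + real N * (e / 2)"
      if "L2_set x {..<N} \<in> S" for x
    proof -
      have "(\<Sum>i<N. \<phi> (kac_proj N x i)) \<le> (\<Sum>i<N. \<phi> (x i) + e / 4 + K * \<bar>kac_proj N x i - x i\<bar>)"
        by (intro sum_mono K(2))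
      also have "\<dots> = (\<Sum>i<N. \<phi> (x i)) + real N * (e / 4) + K * (\<Sum>i<N. \<bar>kac_proj N x i - x i\<bar>)"
        by (simp add: sum.distrib sum_distrib_left)
      also have "K * (\<Sum>i<N. \<bar>kac_proj N x i - x i\<bar>) \<le> K * (\<delta> * real N)"
        using sum_abs_kac_proj_diff_le[OF N _ \<delta>(2), of x] that K(1)
        by (intro mult_left_mono) (auto simp: S_def)
      also have "\<dots> \<le> (e / 4) * real N"
        using \<delta>(3) mult_right_mono[of "K * \<delta>" "e / 4" "real N"] by (simp add: mult.assoc)
      finally show ?thesis by (simp add: algebra_simps)
    qed
    have "ennreal (1/2) * ennreal J \<le> emeasure ?G {x \<in> space (borel_Rn N). L2_set x {..<N} \<in> S} * ennreal J"
      using elim by (intro mult_right_mono) (auto simp: S_def)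
    also have "\<dots> = (\<integral>\<^sup>+ x. ennreal (exp (\<Sum>i<N. \<phi> (kac_proj N x i))) * indicator S (L2_set x {..<N}) \<partial>?G)"
      unfolding nnJ[symmetric]
      by (rule nn_integral_gaussian_kac_proj[OF N, symmetric]) measurable
    also have "\<dots> \<le> (\<integral>\<^sup>+ x. ennreal (exp (real N * (e / 2))) * (\<Prod>i<N. ennreal (exp (\<phi> (x i)))) \<partial>?G)"
    proof (intro nn_integral_mono)
      fix x :: "nat \<Rightarrow> real"
      have "exp (\<Sum>i<N. \<phi> (kac_proj N x i)) \<le> exp (real N * (e / 2)) * (\<Prod>i<N. exp (\<phi> (x i)))"
        if "L2_set x {..<N} \<in> S"
        using bound[OF that] by (simp add: exp_sum[symmetric] exp_add[symmetric] add.commute)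
      then show "ennreal (exp (\<Sum>i<N. \<phi> (kac_proj N x i))) * indicator S (L2_set x {..<N})
          \<le> ennreal (exp (real N * (e / 2))) * (\<Prod>i<N. ennreal (exp (\<phi> (x i))))"
        by (auto simp: prod_ennreal ennreal_mult[symmetric] prod_nonneg ennreal_leI split: split_indicator)
    qed
    also have "\<dots> = ennreal (exp (real N * (e / 2))) * (\<integral>\<^sup>+ x. (\<Prod>i<N. ennreal (exp (\<phi> (x i)))) \<partial>?G)"
      by (rule nn_integral_cmult) measurable
    also have "(\<integral>\<^sup>+ x. (\<Prod>i<N. ennreal (exp (\<phi> (x i)))) \<partial>?G) = ennreal I ^ N"
      by (subst PG.product_nn_integral_prod) (auto simp: nnI)
    also have "ennreal (exp (real N * (e / 2))) * ennreal I ^ N = ennreal (exp (real N * (e / 2)) * I ^ N)"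
      using I by (simp add: ennreal_power ennreal_mult)
    finally have "ennreal (1 / 2 * J) \<le> ennreal (exp (real N * (e / 2)) * I ^ N)"
      using J by (subst ennreal_mult) auto
    then have "1 / 2 * J \<le> exp (real N * (e / 2)) * I ^ N"
      using I by (subst (asm) ennreal_le_iff) auto
    then have "J \<le> 2 * (exp (real N * (e / 2)) * I ^ N)" by simp
    then have "ln J \<le> ln (2 * (exp (real N * (e / 2)) * I ^ N))"
      using I J by (subst ln_le_cancel_iff) auto
    also have "\<dots> = ln 2 + (real N * (e / 2) + real N * ln I)"
      using I by (simp add: ln_mult ln_realpow)
    also have "ln 2 \<le> real N * (e / 2)"
      using elim(3) e by (simp add: field_simps)
    finally show ?case unfolding J_def[symmetric] I_def[symmetric] by (simp add: algebra_simps)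
  qed
qed

section \<open>First marginal and support of the projected measure\<close>

text \<open>Swapping coordinates 0 and i preserves the measure. A sum over coordinates thus reduces
  to the first marginal, the only one the entropy bound needs.\<close>

lemma kac_pushforward_integral_component:
  fixes \<phi> :: "real \<Rightarrow> real"
  assumes \<mu>: "prob_space \<mu>" "sets \<mu> = sets borel" and [measurable]: "\<phi> \<in> borel_measurable borel"
    and i: "i < N"
  shows "(\<integral>x. \<phi> (x i) \<partial>kac_pushforward \<mu> N) = (\<integral>x. \<phi> (x 0) \<partial>kac_pushforward \<mu> N)"
proof -
  let ?F = "kac_pushforward \<mu> N"
  have p: "Transposition.transpose 0 i permutes {..<N}"
    using i by (intro permutes_swap_id) auto
  have sets[measurable_cong]: "sets ?F = sets (borel_Rn N)" by (simp add: kac_pushforward_def)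
  have d: "distr ?F (borel_Rn N) (\<lambda>x. x \<circ> Transposition.transpose 0 i) = ?F"
    using sym_prob_kac_pushforward[OF \<mu>, of N] p by (simp add: sym_prob_def)
  have [measurable]: "(\<lambda>x. x \<circ> Transposition.transpose 0 i) \<in> measurable (borel_Rn N) (borel_Rn N)"
  proof (rule measurable_PiM_single')
    show "(\<lambda>x. (x \<circ> Transposition.transpose 0 i) j) \<in> borel_measurable (borel_Rn N)" if "j \<in> {..<N}" for j
      using permutes_in_image[OF p, of j] that by (auto intro!: measurable_component_singleton)
    show "(\<lambda>x. x \<circ> Transposition.transpose 0 i) \<in> space (borel_Rn N) \<rightarrow> ({..<N} \<rightarrow>\<^sub>E space borel)"
      using permutes_not_in[OF p] by (auto simp: space_PiM PiE_iff extensional_def)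
  qed
  have [measurable]: "(\<lambda>x. \<phi> (x 0)) \<in> borel_measurable (borel_Rn N)"
    using i by (intro measurable_compose[OF measurable_component_singleton]) auto
  have "(\<integral>x. \<phi> (x 0) \<partial>?F) = (\<integral>x. \<phi> ((x \<circ> Transposition.transpose 0 i) 0) \<partial>?F)"
    by (subst d[symmetric], subst integral_distr) auto
  then show ?thesis by simp
qed

lemma tendsto_kac_pushforward_integral_component:
  fixes \<phi> :: "real \<Rightarrow> real"
  assumes \<mu>: "prob_space \<mu>" and sets: "sets \<mu> = sets borel"
    and int: "integrable \<mu> (\<lambda>x. x\<^sup>2)" and one: "(\<integral>x. x\<^sup>2 \<partial>\<mu>) = 1"
    and cont: "continuous_on UNIV \<phi>" and bd: "\<And>x. \<bar>\<phi> x\<bar> \<le> M"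
  shows "(\<lambda>N. \<integral>x. \<phi> (x 0) \<partial>kac_pushforward \<mu> N) \<longlonglongrightarrow> (\<integral>x. \<phi> x \<partial>\<mu>)"
proof -
  have [measurable]: "\<phi> \<in> borel_measurable borel" using cont by (rule borel_measurable_continuous_onI)
  have "continuous_map (top_Rn 1) euclideanreal (\<phi> \<circ> (\<lambda>x. x 0))"
    using cont by (intro continuous_map_compose[OF continuous_map_product_projection]) auto
  moreover have "bounded ((\<phi> \<circ> (\<lambda>x. x 0)) ` topspace (top_Rn 1))"
    unfolding bounded_iff using bd by auto
  ultimately have lim: "(\<lambda>N. \<integral>x. (\<phi> \<circ> (\<lambda>x. x 0)) x \<partial>marginal 1 (kac_pushforward \<mu> N))
      \<longlonglongrightarrow> (\<integral>x. (\<phi> \<circ> (\<lambda>x. x 0)) x \<partial>tensor_power \<mu> 1)"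
    using weak_conv_marginal_kac_pushforward[OF \<mu> sets int one, of 1]
    unfolding weak_conv_top_def by blast
  have rhs: "(\<integral>x. (\<phi> \<circ> (\<lambda>x. x 0)) x \<partial>tensor_power \<mu> 1) = (\<integral>x. \<phi> x \<partial>\<mu>)"
    using product_integral_component(1)[OF \<mu>, of "0::nat" "{..<1}" \<phi>] by (simp add: measurable_cong_sets[OF sets refl])
  have lhs: "(\<integral>x. (\<phi> \<circ> (\<lambda>x. x 0)) x \<partial>marginal 1 (kac_pushforward \<mu> N)) = (\<integral>x. \<phi> (x 0) \<partial>kac_pushforward \<mu> N)"
    if "1 \<le> N" for N
  proof -
    have "(\<lambda>x. restrict x {..<1}) \<in> measurable (kac_pushforward \<mu> N) (borel_Rn 1)"
      using that unfolding kac_pushforward_def measurable_distr_eq1 by (intro measurable_restrict_subset) auto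
    moreover have "\<phi> \<circ> (\<lambda>x. x 0) \<in> borel_measurable (borel_Rn 1)"
      by (intro measurable_comp[OF measurable_component_singleton]) auto
    ultimately show ?thesis
      unfolding marginal_def by (subst integral_distr) auto
  qed
  show ?thesis
    using lim unfolding rhs
    by (rule Lim_transform_eventually) (auto intro!: eventually_sequentiallyI[of 1] simp: lhs[simplified])
qed

text \<open>Only the origin is projected off the sphere, and a nonzero first coordinate already
  excludes it.\<close>

lemma kac_sphere_kac_pushforward:
  assumes N: "0 < N" and \<mu>: "prob_space \<mu>" "sets \<mu> = sets borel" and nz: "AE x in \<mu>. x \<noteq> 0"
  shows "emeasure (kac_pushforward \<mu> N) (kac_sphere N) = 1"
proof -
  interpret F: prob_space "kac_pushforward \<mu> N" by (rule prob_space_kac_pushforward) fact+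
  have [measurable_cong]: "sets (tensor_power \<mu> N) = sets (borel_Rn N)"
    by (intro sets_PiM_cong refl \<mu>(2))
  have [measurable]: "kac_sphere N \<in> sets (borel_Rn N)" unfolding kac_sphere_def by measurable
  have "AE x in tensor_power \<mu> N. x 0 \<noteq> 0"
    using N \<mu> nz by (intro AE_PiM_component) auto
  then have "AE x in tensor_power \<mu> N. kac_proj N x \<in> kac_sphere N"
  proof eventually_elim
    case (elim x)
    have "L2_set x {..<N} \<noteq> 0" using elim N by (auto simp: L2_set_eq_0_iff)
    moreover have "(L2_set x {..<N})\<^sup>2 = (\<Sum>i<N. (x i)\<^sup>2)" by (simp add: L2_set_def sum_nonneg)
    moreover have "(\<Sum>i<N. (kac_proj N x i)\<^sup>2) = real N / (L2_set x {..<N})\<^sup>2 * (\<Sum>i<N. (x i)\<^sup>2)"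
      by (simp add: kac_proj_def power_mult_distrib power_divide sum_distrib_left)
    ultimately have "(\<Sum>i<N. (kac_proj N x i)\<^sup>2) = real N"
      by (metis nonzero_eq_divide_eq power_not_zero times_divide_eq_left)
    then show ?case by (auto simp: kac_sphere_def kac_proj_def space_PiM)
  qed
  then have "AE x in kac_pushforward \<mu> N. x \<in> kac_sphere N"
    unfolding kac_pushforward_def by (subst AE_distr_iff) auto
  then show ?thesis
    by (intro F.emeasure_eq_1_AE) (auto simp: kac_pushforward_def)
qed

section \<open>Uniformly continuous test functions\<close>

lemma uniformly_continuous_on_compact_support:
  fixes \<phi> :: "real \<Rightarrow> real"
  assumes cont: "continuous_on UNIV \<phi>" and supp: "\<And>x. a \<le> \<bar>x\<bar> \<Longrightarrow> \<phi> x = 0"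
  shows "uniformly_continuous_on UNIV \<phi>"
  unfolding uniformly_continuous_on_def
proof (intro allI impI)
  fix e :: real assume e: "0 < e"
  \<comment> \<open>The margin 1 ensures that two points closer than 1 either both lie in this ball
    or both lie where \<phi> vanishes.\<close>
  have "uniformly_continuous_on (cball 0 (a + 1)) \<phi>"
    using cont by (intro compact_uniformly_continuous) (auto intro: continuous_on_subset)
  then obtain d where d: "0 < d" "\<And>x y. x \<in> cball 0 (a + 1) \<Longrightarrow> y \<in> cball 0 (a + 1) \<Longrightarrow> dist y x < d \<Longrightarrow> dist (\<phi> y) (\<phi> x) < e"
    using e unfolding uniformly_continuous_on_def by metis
  show "\<exists>d>0. \<forall>x\<in>UNIV. \<forall>y\<in>UNIV. dist y x < d \<longrightarrow> dist (\<phi> y) (\<phi> x) < e"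
  proof (intro exI[of _ "min d 1"] conjI ballI impI)
    fix x y :: real assume xy: "dist y x < min d 1"
    show "dist (\<phi> y) (\<phi> x) < e"
    proof (cases "x \<in> cball 0 (a + 1) \<and> y \<in> cball 0 (a + 1)")
      case False
      then have "a \<le> \<bar>x\<bar>" "a \<le> \<bar>y\<bar>" using xy by (auto simp: dist_real_def)
      then show ?thesis using supp e by simp
    qed (use xy d in auto)
  qed (use d in auto)
qed

text \<open>A Lebesgue measurable function is an almost everywhere limit of continuous ones.
  Clamping to [-M, M] and multiplying by a growing compactly supported cutoff supplies the bound and
  uniform continuity without changing the limit.\<close>

lemma bounded_measurable_AE_limit_uniformly_continuous:
  fixes \<Phi> :: "real \<Rightarrow> real"
  assumes [measurable]: "\<Phi> \<in> borel_measurable borel" and bd: "\<And>x. \<bar>\<Phi> x\<bar> \<le> M"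
  obtains \<phi> where "\<And>n. uniformly_continuous_on UNIV (\<phi> n)" "\<And>n x. \<bar>\<phi> n x\<bar> \<le> M"
    "AE x in lborel. (\<lambda>n. \<phi> n x) \<longlonglongrightarrow> \<Phi> x"
proof -
  have "\<Phi> \<in> borel_measurable lebesgue"
    using measurable_completion[of \<Phi> lborel borel] by simp
  then have "\<Phi> measurable_on UNIV"
    by (rule lebesgue_measurable_imp_measurable_on) simp
  then obtain T g where T: "negligible T" and g: "\<And>n. continuous_on UNIV (g n)"
    and lim: "\<And>x. x \<notin> T \<Longrightarrow> (\<lambda>n. g n x) \<longlonglongrightarrow> \<Phi> x"
    unfolding measurable_on_def by auto
  have M: "0 \<le> M" using bd[of 0] by linarith
  define \<phi> where "\<phi> n x = max (- M) (min M (g n x)) * max 0 (min 1 (real n - \<bar>x\<bar>))" for n :: nat and x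
  have "uniformly_continuous_on UNIV (\<phi> n)" for n
  proof (rule uniformly_continuous_on_compact_support)
    show "continuous_on UNIV (\<phi> n)"
      unfolding \<phi>_def by (intro continuous_intros g)
    show "\<phi> n x = 0" if "real n \<le> \<bar>x\<bar>" for x
      using that by (simp add: \<phi>_def max_def)
  qed
  moreover have "\<bar>\<phi> n x\<bar> \<le> M" for n x
  proof -
    have "\<bar>\<phi> n x\<bar> \<le> M * 1"
      unfolding \<phi>_def abs_mult using M by (intro mult_mono) auto
    then show ?thesis by simp
  qed
  moreover have "AE x in lborel. (\<lambda>n. \<phi> n x) \<longlonglongrightarrow> \<Phi> x"
  proof -
    have "AE x in lebesgue. x \<notin> T"
      using T by (intro AE_not_in) (simp add: negligible_iff_null_sets)
    then have "AE x in lborel. x \<notin> T" by (simp add: AE_completion_iff)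
    then show ?thesis
    proof eventually_elim
      case (elim x)
      have "(\<lambda>n. max (- M) (min M (g n x))) \<longlonglongrightarrow> max (- M) (min M (\<Phi> x))"
        by (intro tendsto_intros lim elim)
      moreover have "max (- M) (min M (\<Phi> x)) = \<Phi> x" using bd[of x] by (auto simp: abs_le_iff)
      moreover have "(\<lambda>n. max 0 (min 1 (real n - \<bar>x\<bar>))) \<longlonglongrightarrow> 1"
      proof (rule tendsto_eventually)
        obtain n0 where "1 + \<bar>x\<bar> \<le> real n0" using real_arch_simple by blast
        then show "\<forall>\<^sub>F n in sequentially. max 0 (min 1 (real n - \<bar>x\<bar>)) = 1"
          by (intro eventually_sequentiallyI[of n0]) auto
      qed
      ultimately show ?case
        unfolding \<phi>_def using tendsto_mult by fastforce
    qed
  qed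
  ultimately show ?thesis by (rule that)
qed

text \<open>If no bounded measurable function exceeded C, neither would the entropy. Absolute
  continuity with respect to Lebesgue measure carries the approximation over to both \<mu> and
  \<nu>, and dominated convergence preserves the strict inequality.\<close>

lemma Donsker_Varadhan_uniformly_continuous:
  fixes \<mu> \<nu> :: "real measure"
  assumes prob: "prob_space \<mu>" "prob_space \<nu>" and sets: "sets \<mu> = sets borel" "sets \<nu> = sets borel"
    and ac: "absolutely_continuous lborel \<mu>" "absolutely_continuous lborel \<nu>" "absolutely_continuous \<nu> \<mu>"
    and C: "ereal C < rel_entropy \<mu> \<nu>"
  obtains \<phi> M where "uniformly_continuous_on UNIV \<phi>" "\<And>x. \<bar>\<phi> x\<bar> \<le> M"
    "C < (\<integral>x. \<phi> x \<partial>\<mu>) - ln (\<integral>x. exp (\<phi> x) \<partial>\<nu>)"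
proof -
  interpret \<mu>: prob_space \<mu> by fact
  interpret \<nu>: prob_space \<nu> by fact
  note [measurable_cong] = sets
  have "\<exists>\<Phi> M. \<Phi> \<in> borel_measurable \<nu> \<and> (\<forall>x. \<bar>\<Phi> x\<bar> \<le> M) \<and> C < (\<integral>x. \<Phi> x \<partial>\<mu>) - ln (\<integral>x. exp (\<Phi> x) \<partial>\<nu>)"
  proof (rule ccontr)
    assume neg: "\<not> ?thesis"
    have "rel_entropy \<mu> \<nu> \<le> ereal C"
    proof (rule rel_entropy_le_Donsker_Varadhan[OF prob(2,1) ac(3)])
      show "sets \<mu> = sets \<nu>" by (simp add: sets)
    qed (use neg in \<open>meson not_less\<close>)
    with C show False by simp
  qed
  then obtain \<Phi> M where "\<Phi> \<in> borel_measurable \<nu>" and bd: "\<And>x. \<bar>\<Phi> x\<bar> \<le> M"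
    and gt: "C < (\<integral>x. \<Phi> x \<partial>\<mu>) - ln (\<integral>x. exp (\<Phi> x) \<partial>\<nu>)" by blast
  then have [measurable]: "\<Phi> \<in> borel_measurable borel" by simp
  obtain \<phi> where uc: "\<And>n. uniformly_continuous_on UNIV (\<phi> n)" and \<phi>bd: "\<And>n x. \<bar>\<phi> n x\<bar> \<le> M"
    and AE: "AE x in lborel. (\<lambda>n. \<phi> n x) \<longlonglongrightarrow> \<Phi> x"
    using bounded_measurable_AE_limit_uniformly_continuous[where \<Phi>=\<Phi>, OF _ bd] by auto
  have [measurable]: "\<phi> n \<in> borel_measurable borel" for n
    using uc by (intro borel_measurable_continuous_onI uniformly_continuous_imp_continuous)
  have AE\<mu>: "AE x in \<mu>. (\<lambda>n. \<phi> n x) \<longlonglongrightarrow> \<Phi> x"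
    using sets by (intro absolutely_continuous_AE[OF _ ac(1) AE]) simp
  have AE\<nu>: "AE x in \<nu>. (\<lambda>n. \<phi> n x) \<longlonglongrightarrow> \<Phi> x"
    using sets by (intro absolutely_continuous_AE[OF _ ac(2) AE]) simp
  have l1: "(\<lambda>n. \<integral>x. \<phi> n x \<partial>\<mu>) \<longlonglongrightarrow> (\<integral>x. \<Phi> x \<partial>\<mu>)"
    by (rule integral_dominated_convergence[where w="\<lambda>_. M"]) (use AE\<mu> \<phi>bd in auto)
  have l2: "(\<lambda>n. \<integral>x. exp (\<phi> n x) \<partial>\<nu>) \<longlonglongrightarrow> (\<integral>x. exp (\<Phi> x) \<partial>\<nu>)"
  proof (rule integral_dominated_convergence[where w="\<lambda>_. exp M"])
    show "AE x in \<nu>. (\<lambda>n. exp (\<phi> n x)) \<longlonglongrightarrow> exp (\<Phi> x)"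
      using AE\<nu> by eventually_elim (rule tendsto_exp)
  qed (use \<phi>bd in \<open>auto simp: abs_le_iff\<close>)
  have pos: "0 < (\<integral>x. exp (\<Phi> x) \<partial>\<nu>)"
    by (rule \<nu>.integral_exp_bounded(2)[OF _ bd]) measurable
  have "(\<lambda>n. (\<integral>x. \<phi> n x \<partial>\<mu>) - ln (\<integral>x. exp (\<phi> n x) \<partial>\<nu>)) \<longlonglongrightarrow> (\<integral>x. \<Phi> x \<partial>\<mu>) - ln (\<integral>x. exp (\<Phi> x) \<partial>\<nu>)"
    using pos by (intro tendsto_intros l1 l2) auto
  from order_tendstoD(1)[OF this gt]
  obtain n where "C < (\<integral>x. \<phi> n x \<partial>\<mu>) - ln (\<integral>x. exp (\<phi> n x) \<partial>\<nu>)"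
    using eventually_happens' sequentially_bot by blast
  with uc \<phi>bd show ?thesis by (rule that)
qed

section \<open>The lower bound and the limit\<close>

lemma kac_pushforward_rel_entropy_lower_bound:
  fixes h :: "real \<Rightarrow> real"
  assumes [measurable]: "h \<in> borel_measurable borel" and h0: "\<And>x. 0 \<le> h x"
    and \<mu>: "\<mu> = density std_gaussian (\<lambda>x. ennreal (h x))" and prob: "prob_space \<mu>"
    and int: "integrable \<mu> (\<lambda>x. x\<^sup>2)" and one: "(\<integral>x. x\<^sup>2 \<partial>\<mu>) = 1"
    and uc: "uniformly_continuous_on UNIV \<phi>" and bd: "\<And>x. \<bar>\<phi> x\<bar> \<le> M"
    and C: "C < (\<integral>x. \<phi> x \<partial>\<mu>) - ln (\<integral>x. exp (\<phi> x) \<partial>std_gaussian)"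
  shows "\<forall>\<^sub>F N in sequentially. ereal C < ereal (1 / real N) * rel_entropy (kac_pushforward \<mu> N) (unif_sphere N)"
proof -
  have sets: "sets \<mu> = sets borel" by (simp add: \<mu>)
  have cont: "continuous_on UNIV \<phi>" using uc by (rule uniformly_continuous_imp_continuous)
  then have [measurable]: "\<phi> \<in> borel_measurable borel" by (rule borel_measurable_continuous_onI)
  \<comment> \<open>One third of the gap pays for the convergence of the first marginal and one for
    the exponential integral over the sphere; the last keeps the inequality strict.\<close>
  define e where "e = ((\<integral>x. \<phi> x \<partial>\<mu>) - ln (\<integral>x. exp (\<phi> x) \<partial>std_gaussian) - C) / 3"
  have e: "0 < e" using C by (simp add: e_def)
  have "\<forall>\<^sub>F N in sequentially. (\<integral>x. \<phi> x \<partial>\<mu>) - e < (\<integral>x. \<phi> (x 0) \<partial>kac_pushforward \<mu> N)"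
    using order_tendstoD(1)[OF tendsto_kac_pushforward_integral_component[OF prob sets int one cont bd], of "(\<integral>x. \<phi> x \<partial>\<mu>) - e"] e
    by simp
  with ln_integral_exp_unif_sphere_le[OF uc bd e] eventually_gt_at_top[of 0]
  show ?thesis
  proof eventually_elim
    case (elim N)
    let ?F = "kac_pushforward \<mu> N" and ?U = "unif_sphere N"
    have N: "0 < N" by fact
    interpret F: prob_space ?F by (rule prob_space_kac_pushforward) fact+
    have setsF[measurable_cong]: "sets ?F = sets (borel_Rn N)" by (simp add: kac_pushforward_def)
    have meas[measurable]: "(\<lambda>x. \<phi> (x i)) \<in> borel_measurable (borel_Rn N)" if "i < N" for i
      using that by (intro measurable_compose[OF measurable_component_singleton]) auto
    have intF: "integrable ?F (\<lambda>x. \<phi> (x i))" if "i < N" for i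
      by (rule F.integrable_const_bound[where B=M])
        (use bd meas[OF that] in \<open>auto simp: measurable_cong_sets[OF setsF refl]\<close>)
    have "(\<integral>x. (\<Sum>i<N. \<phi> (x i)) \<partial>?F) = (\<Sum>i<N. \<integral>x. \<phi> (x i) \<partial>?F)"
      using intF by (intro Bochner_Integration.integral_sum) auto
    also have "\<dots> = (\<Sum>i<N. \<integral>x. \<phi> (x 0) \<partial>?F)"
      by (intro sum.cong refl kac_pushforward_integral_component prob sets) auto
    finally have lin: "(\<integral>x. (\<Sum>i<N. \<phi> (x i)) \<partial>?F) = real N * (\<integral>x. \<phi> (x 0) \<partial>?F)" by simp
    have "real N * C < real N * (((\<integral>x. \<phi> x \<partial>\<mu>) - e) - (ln (\<integral>x. exp (\<phi> x) \<partial>std_gaussian) + e))"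
      using N e unfolding e_def by (intro mult_strict_left_mono) (auto simp: field_simps)
    also have "\<dots> \<le> real N * (\<integral>x. \<phi> (x 0) \<partial>?F) - real N * (ln (\<integral>x. exp (\<phi> x) \<partial>std_gaussian) + e)"
      unfolding right_diff_distrib[symmetric] using elim(3) by (intro mult_left_mono) auto
    also have "\<dots> \<le> (\<integral>x. (\<Sum>i<N. \<phi> (x i)) \<partial>?F) - ln (\<integral>x. exp (\<Sum>i<N. \<phi> (x i)) \<partial>?U)"
      unfolding lin using elim(1) by linarith
    finally have 1: "real N * C < (\<integral>x. (\<Sum>i<N. \<phi> (x i)) \<partial>?F) - ln (\<integral>x. exp (\<Sum>i<N. \<phi> (x i)) \<partial>?U)" .
    have 2: "ereal ((\<integral>x. (\<Sum>i<N. \<phi> (x i)) \<partial>?F) - ln (\<integral>x. exp (\<Sum>i<N. \<phi> (x i)) \<partial>?U)) \<le> rel_entropy ?F ?U"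
    proof (rule Donsker_Varadhan_le[where B="\<Sum>i<N. M"])
      show "prob_space ?U" using N by (rule prob_space_unif_sphere)
      show "prob_space ?F" by unfold_locales
      show "absolutely_continuous ?U ?F"
        by (rule kac_pushforward_absolutely_continuous[OF N _ h0 \<mu> prob]) measurable
      show "sets ?F = sets ?U" by (simp add: setsF unif_sphere_def)
      show "(\<lambda>x. \<Sum>i<N. \<phi> (x i)) \<in> borel_measurable ?U"
        unfolding unif_sphere_def by simp
      show "\<bar>\<Sum>i<N. \<phi> (x i)\<bar> \<le> (\<Sum>i<N. M)" for x
        by (rule order_trans[OF sum_abs]) (intro sum_mono bd)
    qed
    from 1 2 have "ereal (real N * C) < rel_entropy ?F ?U"
      by (meson ereal_less(3) less_ereal.simps(1) less_le_trans)
    then have "ereal (1 / real N) * ereal (real N * C) < ereal (1 / real N) * rel_entropy ?F ?U"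
      using N by (intro ereal_mult_strict_left_mono) auto
    then show ?case using N by simp
  qed
qed

theorem theorem27:
  fixes f :: "real \<Rightarrow> real" and \<mu> :: "real measure"
  defines "\<mu> \<equiv> density lborel (\<lambda>x. ennreal (f x))"
  assumes "f \<in> borel_measurable borel"
    and "\<And>x. 0 \<le> f x"
    and "has_bochner_integral lborel f 1"
    and "has_bochner_integral lborel (\<lambda>x. x\<^sup>2 * f x) 1"
    and "rel_entropy \<mu> std_gaussian < \<infinity>"
  shows "entropically_chaotic (kac_pushforward \<mu>) \<mu>"
proof -
  note [measurable] = assms(2) and f0 = assms(3)
  \<comment> \<open>The Gaussian density vanishes nowhere, so this quotient is a finite density of
    \<mu> with respect to it.\<close>
  define h where "h x = f x / std_normal_density x" for x
  have [measurable]: "h \<in> borel_measurable borel" unfolding h_def by measurable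
  have h0: "0 \<le> h x" for x by (simp add: h_def f0)
  have \<mu>h: "\<mu> = density std_gaussian (\<lambda>x. ennreal (h x))"
    unfolding \<mu>_def
    by (subst density_density_eq)
      (auto simp: h_def f0 ennreal_mult[symmetric] normal_density_pos less_imp_neq[symmetric] intro!: density_cong)
  have sets: "sets \<mu> = sets borel" by (simp add: \<mu>_def)
  have prob: "prob_space \<mu>"
  proof
    have "emeasure \<mu> (space \<mu>) = (\<integral>\<^sup>+x. ennreal (f x) \<partial>lborel)"
      unfolding \<mu>_def by (simp add: emeasure_density)
    also have "\<dots> = 1"
      using assms(4) f0 by (subst nn_integral_eq_integral) (auto simp: has_bochner_integral_iff)
    finally show "emeasure \<mu> (space \<mu>) = 1" .
  qed
  have int: "integrable \<mu> (\<lambda>x. x\<^sup>2)" and one: "(\<integral>x. x\<^sup>2 \<partial>\<mu>) = 1"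
    using assms(5) f0 unfolding \<mu>_def
    by (simp_all add: integrable_density integral_density has_bochner_integral_iff mult.commute)
  have ac: "absolutely_continuous lborel \<mu>" "absolutely_continuous lborel std_gaussian"
      "absolutely_continuous std_gaussian \<mu>"
    unfolding \<mu>h by (auto intro!: absolutely_continuousI_density) (auto simp: \<mu>h[symmetric] \<mu>_def intro!: absolutely_continuousI_density)
  define H where "H = (\<integral>x. ln (h x) \<partial>\<mu>)"
  note fin = rel_entropy_density_finite[OF prob_space_std_gaussian _ h0 \<mu>h assms(6), simplified]
  have intL: "integrable \<mu> (\<lambda>x. ln (h x))"
    unfolding \<mu>h using fin(1) by (subst integrable_density) (auto simp: h0)
  have H: "rel_entropy \<mu> std_gaussian = ereal H"
    unfolding fin(2) H_def unfolding \<mu>h by (subst (2) integral_density) (auto simp: h0)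
  \<comment> \<open>Without an atom at 0 the projection almost surely avoids its default value at
    the origin.\<close>
  have "AE x in lborel. (x::real) \<noteq> 0" by (rule AE_lborel_singleton)
  then have nz: "AE x in \<mu>. x \<noteq> 0"
    unfolding \<mu>_def by (subst AE_density) auto
  show ?thesis
    unfolding entropically_chaotic_def kac_chaotic_def
  proof (intro conjI allI impI assms(6))
    show "emeasure (kac_pushforward \<mu> N) (kac_sphere N) = 1" if "1 \<le> N" for N
      using that by (intro kac_sphere_kac_pushforward prob sets nz) auto
    show "sym_prob N (kac_pushforward \<mu> N)" for N
      by (intro sym_prob_kac_pushforward prob sets)
    show "weak_conv_top (top_Rn k) (\<lambda>N. marginal k (kac_pushforward \<mu> N)) (tensor_power \<mu> k)" for k
      by (intro weak_conv_marginal_kac_pushforward prob sets int one)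
    show "(\<lambda>N. ereal (1 / real N) * rel_entropy (kac_pushforward \<mu> N) (unif_sphere N))
        \<longlonglongrightarrow> rel_entropy \<mu> std_gaussian"
      unfolding H
    \<comment> \<open>The lower half needs a real \<open>C\<close> strictly between \<open>a\<close>
      and \<open>H\<close>, which also covers \<open>a\<close> = -\<infinity>. The upper half has no
      error term and holds for every N \<ge> 1.\<close>
    proof (rule order_tendstoI)
      fix a assume "a < ereal H"
      then obtain C where C: "a < ereal C" "C < H" using ereal_dense2 by fastforce
      then have "ereal C < rel_entropy \<mu> std_gaussian" by (simp add: H)
      from Donsker_Varadhan_uniformly_continuous[OF prob prob_space_std_gaussian sets _ ac this]
      obtain \<phi> M where \<phi>: "uniformly_continuous_on UNIV \<phi>" "\<And>x. \<bar>\<phi> x\<bar> \<le> M"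
        "C < (\<integral>x. \<phi> x \<partial>\<mu>) - ln (\<integral>x. exp (\<phi> x) \<partial>std_gaussian)" by auto
      from kac_pushforward_rel_entropy_lower_bound[OF _ h0 \<mu>h prob int one \<phi>]
      have "\<forall>\<^sub>F N in sequentially. ereal C < ereal (1 / real N) * rel_entropy (kac_pushforward \<mu> N) (unif_sphere N)"
        by simp
      then show "\<forall>\<^sub>F N in sequentially. a < ereal (1 / real N) * rel_entropy (kac_pushforward \<mu> N) (unif_sphere N)"
        by eventually_elim (use C(1) in order)
    next
      fix a assume a: "ereal H < a"
      show "\<forall>\<^sub>F N in sequentially. ereal (1 / real N) * rel_entropy (kac_pushforward \<mu> N) (unif_sphere N) < a"
        using eventually_gt_at_top[of 0]
      proof eventually_elim
        case (elim N)
        have "rel_entropy (kac_pushforward \<mu> N) (unif_sphere N) \<le> ereal (real N * H)"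
          unfolding H_def by (rule rel_entropy_kac_pushforward_le[OF elim _ h0 \<mu>h prob intL]) measurable
        then have "ereal (1 / real N) * rel_entropy (kac_pushforward \<mu> N) (unif_sphere N)
            \<le> ereal (1 / real N) * ereal (real N * H)"
          by (intro ereal_mult_left_mono) auto
        also have "\<dots> = ereal H" using elim by simp
        finally show ?case using a by simp
      qed
    qed
  qed
qed

end
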